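(* For every $\varepsilon\in(0,1/2)$ there is $C_\varepsilon>0$ (depending only on $\varepsilon$) such that for every integer $r\ge 5$ and all positive integers $k,\ell$, \[R(k+1,\ell+1)\le 2^{C_\varepsilon r^2}\exp(-\phi_{r,\varepsilon}(k,\ell))\binom{k+\ell}{k}.\]
   Context: $R(a,b)$ is the smallest $n$ such that every graph on $n$ vertices contains a clique of size $a$ or an independent set of size $b$. Let $\tau(x)=6x^5-15x^4+10x^3$. For $r\ge 5$ and $\varepsilon\in(0,1/2)$ define $\rho_{r,\varepsilon}\colon[0,\infty)\to[0,\infty)$ by $\rho_{r,\varepsilon}(x)=0$ for $x\in[0,\varepsilon]$, $\rho_{r,\varepsilon}(x)=(r-4)\tau((x-\varepsilon)/(1-\varepsilon))/4$ for $x\in[\varepsilon,1]$, and $\rho_{r,\varepsilon}(x)=\rho_{r,\varepsilon}(1/x)$ for $x\in[1,\infty)$; and define $\phi_{r,\varepsilon}(k,\ell)=\rho_{r,\varepsilon}(\ell/k)\log(k+\ell)$, with $\log$ the natural logarithm. *)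

theory Defs
  imports "HOL-Analysis.Analysis"
begin

text \<open>A graph on vertex set {..<n} is given by a symmetric adjacency relation E
  (loops are irrelevant, as only pairs of distinct vertices are inspected).\<close>

definition is_clique :: "(nat \<Rightarrow> nat \<Rightarrow> bool) \<Rightarrow> nat set \<Rightarrow> bool" where
  "is_clique E K \<longleftrightarrow> (\<forall>x\<in>K. \<forall>y\<in>K. x \<noteq> y \<longrightarrow> E x y)"

definition is_indep :: "(nat \<Rightarrow> nat \<Rightarrow> bool) \<Rightarrow> nat set \<Rightarrow> bool" where
  "is_indep E K \<longleftrightarrow> (\<forall>x\<in>K. \<forall>y\<in>K. x \<noteq> y \<longrightarrow> \<not> E x y)"

definition ramsey_prop :: "nat \<Rightarrow> nat \<Rightarrow> nat \<Rightarrow> bool" where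
  "ramsey_prop a b n \<longleftrightarrow>
     (\<forall>E. (\<forall>x y. E x y = E y x) \<longrightarrow>
        (\<exists>K\<subseteq>{..<n}. card K = a \<and> is_clique E K) \<or>
        (\<exists>K\<subseteq>{..<n}. card K = b \<and> is_indep E K))"

definition ramsey_number :: "nat \<Rightarrow> nat \<Rightarrow> nat" where
  "ramsey_number a b = (LEAST n. ramsey_prop a b n)"

definition tau :: "real \<Rightarrow> real" where
  "tau x = 6 * x ^ 5 - 15 * x ^ 4 + 10 * x ^ 3"

definition rho0 :: "nat \<Rightarrow> real \<Rightarrow> real \<Rightarrow> real" where
  "rho0 r eps x = (if x \<le> eps then 0 else (real r - 4) * tau ((x - eps) / (1 - eps)) / 4)"

definition rho :: "nat \<Rightarrow> real \<Rightarrow> real \<Rightarrow> real" where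
  "rho r eps x = (if x \<le> 1 then rho0 r eps x else rho0 r eps (1 / x))"

definition phi :: "nat \<Rightarrow> real \<Rightarrow> nat \<Rightarrow> nat \<Rightarrow> real" where
  "phi r eps k l = rho r eps (real l / real k) * ln (real k + real l)"

end

theory Submission
  imports Defs "HOL-Real_Asymp.Real_Asymp"
begin

text \<open>
  Only an improvement of the Erdos-Szekeres bound by a factor \<open>exp (- (ln (k + l))\<^sup>2 / 64)\<close> is needed,
  and only when \<open>k\<close> and \<open>l\<close> are comparable: since \<open>tau \<le> 1\<close>, the exponent \<open>phi\<close> is at most
  \<open>r ln (k + l) / 4 \<le> r\<^sup>2 + (ln (k + l))\<^sup>2 / 64\<close>. This improvement comes from a two-colour, off-diagonal
  version of the book argument of Balister, Bollobas, Campos, Griffiths, Hurley, Morris, Sahasrabudhe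
  and Tiba. As long as some vertex has noticeably more than the share \<open>k / (k + l)\<close> of red (or
  \<open>l / (k + l)\<close> of blue) neighbours, pass to that neighbourhood; each such step gains a factor over
  Erdos-Szekeres. In a graph without such vertices one finds a red or blue clique of size \<open>t\<close>
  with almost the expected number of common neighbours in that colour. Replacing \<open>k\<close> by \<open>k - t\<close> then gains
  \<open>exp (- c t\<^sup>2 / (k + l))\<close>, because the share of the shrinking colour drops along the way.
\<close>

section \<open>A positive definite form\<close>

text \<open>The entire function \<open>cosh (sqrt x)\<close>: its Taylor coefficients are nonnegative, it is bounded on
  the negative axis, and it grows only like \<open>exp (sqrt x)\<close>. The last point is what keeps the loss in
  each density increment affordable.\<close>

definition csq :: "real \<Rightarrow> real" where
  "csq x = (if 0 \<le> x then cosh (sqrt x) else cos (sqrt (- x)))"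

lemma csq_sums: "(\<lambda>n. x ^ n / fact (2 * n)) sums csq x"
proof (cases "0 \<le> x")
  case True
  let ?h = "\<lambda>n. if even n then sqrt x ^ n /\<^sub>R fact n else 0"
  have s: "?h sums cosh (sqrt x)"
    by (rule cosh_converges)
  \<comment> \<open>The odd terms of the cosh series vanish, so passing to even indices keeps the
    sum.\<close>
  have "(\<lambda>n. ?h (2 * n)) sums cosh (sqrt x)"
    by (subst sums_mono_reindex[of "\<lambda>n. 2 * n" ?h]) (use s in \<open>auto simp: strict_mono_def image_iff\<close>)
  moreover have "?h (2 * n) = x ^ n / fact (2 * n)" for n
    using True by (simp add: power_mult divide_inverse_commute)
  ultimately show ?thesis
    using True by (simp add: csq_def)
next
  case False
  have "(- 1) ^ n / fact (2 * n) * sqrt (- x) ^ (2 * n) = x ^ n / fact (2 * n)" for n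
    using False by (simp add: power_mult power_mult_distrib[symmetric])
  then show ?thesis
    using cos_paired[of "sqrt (- x)"] False by (simp add: csq_def)
qed

lemma csq_ge: "- 1 \<le> csq x"
  by (simp add: csq_def order_trans[OF _ cosh_real_ge_1])

lemma csq_nonpos_le: "x \<le> 0 \<Longrightarrow> csq x \<le> 1"
  by (auto simp: csq_def)

lemma csq_le: 
  assumes "x \<le> L" "0 \<le> L" shows "csq x \<le> exp (sqrt L)"
proof (cases "0 \<le> x")
  case True
  have "cosh (sqrt x) \<le> exp (sqrt x)"
    using True by (simp add: cosh_def)
  also have "\<dots> \<le> exp (sqrt L)" using assms by simp
  finally show ?thesis using True by (simp add: csq_def)
next
  case False
  have "cos (sqrt (- x)) \<le> 1" "1 \<le> exp (sqrt L)" using assms by simp_all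
  then show ?thesis using False by (simp add: csq_def del: one_le_exp_iff cos_le_one)
qed

text \<open>Three Taylor terms suffice, since \<open>2 + (1 + x / 2 + x\<^sup>2 / 24) - x\<close>
  equals \<open>((x - 6)\<^sup>2 + 36) / 24\<close>. This lets a positive entry be absorbed into the
  factor \<open>2 + csq y\<close>.\<close>

lemma le_two_plus_csq:
  assumes "0 \<le> x" shows "x \<le> 2 + csq x"
proof -
  have "(\<Sum>n<3. x ^ n / fact (2 * n)) \<le> csq x"
    unfolding sums_unique[OF csq_sums] 
    by (rule sum_le_suminf) (use assms csq_sums sums_summable in auto)
  also have "(\<Sum>n<3. x ^ n / fact (2 * n)) = 1 + x / 2 + x\<^sup>2 / 24"
    by (simp add: numeral_3_eq_3 power2_eq_square)
  moreover have "0 \<le> (x - 6)\<^sup>2" by simp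
  ultimately show ?thesis by (simp add: power2_eq_square algebra_simps)
qed

text \<open>A positive \<open>x\<close> is at most \<open>2 * exp (sqrt L)\<close> by the quadratic
  Taylor bound, and \<open>2 + csq y\<close> is at most \<open>3 * exp (sqrt L)\<close>. For
  negative \<open>x\<close> the product has the right sign because \<open>2 + csq y\<close> is at
  least 1.\<close>

lemma mult_csq_le:
  assumes "x \<le> L" "y \<le> L" "0 \<le> L"
  shows "x * (2 + csq y) \<le> 6 * exp (2 * sqrt L)"
proof (cases "0 \<le> x")
  case True
  have "(sqrt L)\<^sup>2 / 2 \<le> exp (sqrt L)"
    using exp_lower_Taylor_quadratic[of "sqrt L"] real_sqrt_ge_zero[OF assms(3)] by linarith
  then have "x \<le> 2 * exp (sqrt L)"
    using assms real_sqrt_ge_zero[OF assms(3)] by (smt (verit) real_sqrt_pow2 field_sum_of_halves)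
  moreover have "2 + csq y \<le> 3 * exp (sqrt L)"
    using csq_le[OF assms(2,3)] assms(3) one_le_exp_iff[of "sqrt L"] by (simp del: one_le_exp_iff)
  moreover have "0 \<le> 2 + csq y" using csq_ge[of y] by simp
  ultimately have "x * (2 + csq y) \<le> (2 * exp (sqrt L)) * (3 * exp (sqrt L))"
    using True by (intro mult_mono) auto
  also have "\<dots> = 6 * exp (2 * sqrt L)" by (simp add: exp_double power2_eq_square)
  finally show ?thesis .
next
  case False
  have "x * (2 + csq y) \<le> 0"
    using False csq_ge[of y] by (intro mult_nonpos_nonneg) auto
  also have "0 \<le> 6 * exp (2 * sqrt L)" by simp
  finally show ?thesis .
qed

text \<open>For \<open>y \<le> 0\<close> the first product alone is at most \<open>x\<close>. For
  \<open>y > 0\<close>, the bounds \<open>y \<le> 2 + csq y\<close> and \<open>csq x \<le> 1\<close>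
  give the total \<open>(x + 3) * (2 + csq y)\<close>; this is where the threshold - 4 comes
  from.\<close>

lemma csq_form_le_neg_one:
  assumes "x \<le> - 4" shows "x * (2 + csq y) + y * (2 + csq x) \<le> - 1"
proof (cases "y \<le> 0")
  case True
  have "y * (2 + csq x) \<le> 0"
    using True csq_ge[of x] by (intro mult_nonpos_nonneg) auto
  moreover have "x * (2 + csq y) \<le> x * 1"
    using assms csq_ge[of y] by (intro mult_left_mono_neg) auto
  ultimately show ?thesis using assms by linarith
next
  case False
  have "y * (2 + csq x) \<le> (2 + csq y) * 3"
    using le_two_plus_csq[of y] csq_nonpos_le[of x] csq_ge[of x] False assms by (intro mult_mono) auto
  then have "x * (2 + csq y) + y * (2 + csq x) \<le> (x + 3) * (2 + csq y)"
    by (simp add: algebra_simps)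
  also have "\<dots> \<le> (x + 3) * 1"
    using assms csq_ge[of y] by (intro mult_left_mono_neg) auto
  also have "\<dots> \<le> - 1" using assms by simp
  finally show ?thesis .
qed

section \<open>Positive semidefinite and Gram kernels\<close>

definition psd :: "'a set \<Rightarrow> ('a \<Rightarrow> 'a \<Rightarrow> real) \<Rightarrow> bool" where
  "psd X K \<longleftrightarrow> (\<forall>w. 0 \<le> (\<Sum>x\<in>X. \<Sum>y\<in>X. w x * w y * K x y))"

definition gram :: "'v set \<Rightarrow> ('v \<Rightarrow> 'a \<Rightarrow> real) \<Rightarrow> 'a \<Rightarrow> 'a \<Rightarrow> real" where
  "gram A s x y = (\<Sum>v\<in>A. s v x * s v y)"

lemma psd_sum_nonneg: "psd X K \<Longrightarrow> 0 \<le> (\<Sum>x\<in>X. \<Sum>y\<in>X. K x y)"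
  unfolding psd_def by (drule spec[of _ "\<lambda>_. 1"]) simp

lemma psd_one: "psd X (\<lambda>x y. 1)"
proof -
  have "(\<Sum>x\<in>X. \<Sum>y\<in>X. w x * w y * 1) = (\<Sum>x\<in>X. w x)\<^sup>2" for w :: "'a \<Rightarrow> real"
    by (simp add: power2_eq_square sum_product)
  then show ?thesis by (simp add: psd_def)
qed

text \<open>A case of the Schur product theorem: expanding the Gram kernel over \<open>v\<close>
  absorbs each \<open>s v\<close> into the weights \<open>w\<close>.\<close>

lemma psd_gram_mult:
  assumes "psd X K" shows "psd X (\<lambda>x y. gram A s x y * K x y)"
  unfolding psd_def
proof
  fix w :: "'a \<Rightarrow> real"
  have "(\<Sum>x\<in>X. \<Sum>y\<in>X. w x * w y * (gram A s x y * K x y))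
      = (\<Sum>x\<in>X. \<Sum>y\<in>X. \<Sum>v\<in>A. (w x * s v x) * (w y * s v y) * K x y)"
    by (simp add: gram_def sum_distrib_left sum_distrib_right mult_ac)
  also have "\<dots> = (\<Sum>x\<in>X. \<Sum>v\<in>A. \<Sum>y\<in>X. (w x * s v x) * (w y * s v y) * K x y)"
    by (intro sum.cong refl) (rule sum.swap)
  also have "\<dots> = (\<Sum>v\<in>A. \<Sum>x\<in>X. \<Sum>y\<in>X. (w x * s v x) * (w y * s v y) * K x y)"
    by (rule sum.swap)
  also have "\<dots> \<ge> 0"
  proof (rule sum_nonneg)
    show "0 \<le> (\<Sum>x\<in>X. \<Sum>y\<in>X. (w x * s v x) * (w y * s v y) * K x y)" for v
      using assms[unfolded psd_def, THEN spec, of "\<lambda>x. w x * s v x"] .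
  qed
  finally show "0 \<le> (\<Sum>x\<in>X. \<Sum>y\<in>X. w x * w y * (gram A s x y * K x y))" .
qed

lemma psd_gram_power: "psd X (\<lambda>x y. gram A s x y ^ n)"
  by (induction n) (simp_all add: psd_one psd_gram_mult)

text \<open>Expanding \<open>csq\<close> in its power series leaves products of Gram kernels with
  nonnegative coefficients, each of nonnegative total. The constant 2 contributes the total of a
  single Gram kernel.\<close>

lemma sum_gram_csq_nonneg:
  "0 \<le> (\<Sum>x\<in>X. \<Sum>y\<in>X. gram A s x y * (2 + csq (gram B u x y)))"
proof -
  let ?a = "\<lambda>n. \<Sum>x\<in>X. \<Sum>y\<in>X. gram A s x y * (gram B u x y ^ n / fact (2 * n))"
  have "?a sums (\<Sum>x\<in>X. \<Sum>y\<in>X. gram A s x y * csq (gram B u x y))"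
    by (intro sums_sum sums_mult csq_sums)
  moreover have "0 \<le> ?a n" for n
  proof -
    have "0 \<le> (\<Sum>x\<in>X. \<Sum>y\<in>X. gram A s x y * gram B u x y ^ n) / fact (2 * n)"
      by (intro divide_nonneg_pos psd_sum_nonneg psd_gram_mult psd_gram_power) auto
    then show ?thesis by (simp add: sum_divide_distrib)
  qed
  ultimately have "0 \<le> (\<Sum>x\<in>X. \<Sum>y\<in>X. gram A s x y * csq (gram B u x y))"
    using sums_le[OF _ sums_zero, of ?a] by blast
  moreover have "0 \<le> (\<Sum>x\<in>X. \<Sum>y\<in>X. gram A s x y * 1)"
    by (intro psd_sum_nonneg psd_gram_mult psd_one)
  ultimately show ?thesis
    by (simp add: distrib_left sum.distrib mult.commute[of _ 2] flip: sum_distrib_left)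
qed

text \<open>The form \<open>x (2 + csq y) + y (2 + csq x)\<close> has nonnegative average over pairs of Gram kernels but is
  at most \<open>- 1\<close> once \<open>x\<close> or \<open>y\<close> drops to \<open>- 4\<close>, so pairs above \<open>- 4\<close> in both kernels must compensate.\<close>

lemma gram_dichotomy:
  fixes s :: "bool \<Rightarrow> 'v \<Rightarrow> 'a \<Rightarrow> real" and A :: "bool \<Rightarrow> 'v set"
  defines "Z \<equiv> \<lambda>c. gram (A c) (s c)"
  assumes X: "finite X" "X \<noteq> {}"
    and le: "\<And>c x y. x \<in> X \<Longrightarrow> y \<in> X \<Longrightarrow> Z c x y \<le> M"
    and L: "0 \<le> L" "L \<le> M"
  shows "(\<exists>x\<in>X. exp (- 2 * sqrt L) / 26 * card X \<le> card {y \<in> X. \<forall>c. - 4 < Z c x y}) \<or>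
    (\<exists>c. \<exists>x\<in>X. exp (- 2 * sqrt M) / 52 * card X \<le> card {y \<in> X. L \<le> Z c x y \<and> (\<forall>c'. - 4 < Z c' x y)})"
proof (rule ccontr)
  assume neg: "\<not> ?thesis"
  define G where "G x = {y \<in> X. \<forall>c. - 4 < Z c x y}" for x
  define H where "H c x = {y \<in> X. L \<le> Z c x y \<and> (\<forall>c'. - 4 < Z c' x y)}" for c x
  define F where "F x y = Z True x y * (2 + csq (Z False x y)) + Z False x y * (2 + csq (Z True x y))" for x y
  have G: "card (G x) < exp (- 2 * sqrt L) / 26 * card X" if "x \<in> X" for x
    using neg that by (auto simp: G_def not_le)
  have H: "card (H c x) < exp (- 2 * sqrt M) / 52 * card X" if "x \<in> X" for c x
    using neg that by (auto simp: H_def not_le)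
  \<comment> \<open>Off the critical pairs \<open>F\<close> is at most - 1. On them it is a sum of
    two products, each at most 6 exponentials, and the added 1 fits into a thirteenth.\<close>
  have point: "F x y + 1 \<le> 13 * exp (2 * sqrt L) * indicator (G x) y
      + (13 * exp (2 * sqrt M) * indicator (H True x) y + 13 * exp (2 * sqrt M) * indicator (H False x) y)"
    (is "_ \<le> ?r") if xy: "x \<in> X" "y \<in> X" for x y
  proof -
    have one: "1 \<le> exp (2 * sqrt L)" "1 \<le> exp (2 * sqrt M)" using L by simp_all
    have r0: "0 \<le> ?r" by simp
    consider c where "Z c x y \<le> - 4" | "y \<in> G x" "\<And>c. Z c x y < L" 
      | c where "y \<in> G x" "L \<le> Z c x y"
      using xy unfolding G_def mem_Collect_eq by (meson not_le)
    then show ?thesis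
    proof cases
      case 1
      have "F x y \<le> - 1"
        using 1 csq_form_le_neg_one[of "Z True x y" "Z False x y"] csq_form_le_neg_one[of "Z False x y" "Z True x y"]
        by (cases c) (auto simp: F_def)
      then show ?thesis using r0 by linarith
    next
      case 2
      have ind: "indicator (G x) y = (1::real)" using 2 by simp
      have "F x y \<le> 6 * exp (2 * sqrt L) + 6 * exp (2 * sqrt L)"
        unfolding F_def using 2(2) L by (intro add_mono mult_csq_le) (auto intro: less_imp_le)
      then have "F x y + 1 \<le> 13 * exp (2 * sqrt L) * indicator (G x) y"
        using one unfolding ind by linarith
      moreover have "\<dots> \<le> ?r" by simp
      ultimately show ?thesis by linarith
    next
      case 3
      have ind: "indicator (H c x) y = (1::real)" using 3 xy by (simp add: H_def G_def)
      have "F x y \<le> 6 * exp (2 * sqrt M) + 6 * exp (2 * sqrt M)"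
        unfolding F_def using le[OF xy] L by (intro add_mono mult_csq_le) auto
      then have "F x y + 1 \<le> 13 * exp (2 * sqrt M) * indicator (H c x) y"
        using one unfolding ind by linarith
      moreover have "\<dots> \<le> ?r"
        by (cases c) auto
      ultimately show ?thesis by linarith
    qed
  qed
  \<comment> \<open>The densities 1/26 and twice 1/52, multiplied by 13, add up to exactly 1. Hence
    the total of \<open>F\<close> would be negative, against
    \<open>sum_gram_csq_nonneg\<close>.\<close>
  have row: "(\<Sum>y\<in>X. F x y + 1) < card X" if x: "x \<in> X" for x
  proof -
    have ind: "(\<Sum>y\<in>X. b * indicator U y) = b * card U" if "U \<subseteq> X" for U and b :: real
      using that X by (simp add: sum_distrib_left[symmetric] indicator_def sum.If_cases Int_absorb1)
    have sub: "G x \<subseteq> X" "H c x \<subseteq> X" for c by (auto simp: G_def H_def)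
    have "(\<Sum>y\<in>X. F x y + 1) \<le> (\<Sum>y\<in>X. 13 * exp (2 * sqrt L) * indicator (G x) y
      + (13 * exp (2 * sqrt M) * indicator (H True x) y + 13 * exp (2 * sqrt M) * indicator (H False x) y))"
      using x by (intro sum_mono point)
    also have "\<dots> = 13 * exp (2 * sqrt L) * card (G x)
       + (13 * exp (2 * sqrt M) * card (H True x) + 13 * exp (2 * sqrt M) * card (H False x))"
      by (simp only: sum.distrib ind[OF sub(1)] ind[OF sub(2)])
    also have "\<dots> < 13 * exp (2 * sqrt L) * (exp (- 2 * sqrt L) / 26 * card X)
       + (13 * exp (2 * sqrt M) * (exp (- 2 * sqrt M) / 52 * card X) + 13 * exp (2 * sqrt M) * (exp (- 2 * sqrt M) / 52 * card X))"
      by (intro add_strict_mono mult_strict_left_mono G H x) auto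
    also have "\<dots> = card X"
      by (simp add: exp_minus)
    finally show ?thesis .
  qed
  have "(\<Sum>x\<in>X. \<Sum>y\<in>X. F x y + 1) < (\<Sum>x\<in>X. card X)"
    unfolding of_nat_sum using X row by (intro sum_strict_mono) auto
  moreover have "(\<Sum>x\<in>X. \<Sum>y\<in>X. F x y + 1) = (\<Sum>x\<in>X. \<Sum>y\<in>X. F x y) + card X * card X"
    by (simp add: sum.distrib)
  moreover have "0 \<le> (\<Sum>x\<in>X. \<Sum>y\<in>X. F x y)"
    unfolding F_def Z_def sum.distrib by (intro add_nonneg_nonneg sum_gram_csq_nonneg)
  ultimately show False by simp
qed

section \<open>Monochromatic books\<close>

text \<open>Loops of \<open>E\<close> are unconstrained, so \<open>x\<close> is excluded explicitly;
  this keeps a clique disjoint from its common neighbourhood.\<close>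

definition nbr :: "(nat \<Rightarrow> nat \<Rightarrow> bool) \<Rightarrow> bool \<Rightarrow> nat \<Rightarrow> nat set" where
  "nbr E c x = {y. y \<noteq> x \<and> E x y = c}"

definition mono_clique :: "(nat \<Rightarrow> nat \<Rightarrow> bool) \<Rightarrow> bool \<Rightarrow> nat set \<Rightarrow> bool" where
  "mono_clique E c K \<longleftrightarrow> (\<forall>x\<in>K. \<forall>y\<in>K. x \<noteq> y \<longrightarrow> E x y = c)"

text \<open>\<open>D\<close> is the mean of both indicators, so one of the two cross terms cancels
  against the constant term. The inner product thus measures how far a codegree deviates from its
  random value.\<close>

lemma centred_inner_product:
  fixes P Q Y :: "'a set" and D :: real
  assumes "finite Y" "P \<subseteq> Y" "Q \<subseteq> Y" "card P = n" "card Q = n" "Y \<noteq> {}"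
  defines "D \<equiv> n / card Y"
  shows "(\<Sum>v\<in>Y. (of_bool (v \<in> P) - D) * (of_bool (v \<in> Q) - D)) = card (P \<inter> Q) - D * n"
proof -
  have i: "(\<Sum>v\<in>Y. of_bool (v \<in> U)) = real (card U)" if "U \<subseteq> Y" for U
    using assms(1) that by (simp add: of_bool_def sum.If_cases Int_absorb1)
  have "(\<Sum>v\<in>Y. (of_bool (v \<in> P) - D) * (of_bool (v \<in> Q) - D))
     = (\<Sum>v\<in>Y. of_bool (v \<in> P \<inter> Q) - D * of_bool (v \<in> P) - D * of_bool (v \<in> Q) + D * D)"
    by (intro sum.cong refl) (auto simp: algebra_simps)
  also have "\<dots> = card (P \<inter> Q) - D * card P - D * card Q + D * D * card Y"
    using assms(2,3) by (simp add: sum.distrib sum_subtractf i[of "P \<inter> Q", simplified] i le_infI1 del: of_bool_conj flip: sum_distrib_left)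
  also have "D * D * card Y = D * n"
    using assms(1,6) by (simp add: D_def)
  finally show ?thesis using assms(4,5) by simp
qed

text \<open>Apply \<open>gram_dichotomy\<close> to the centred indicators of the neighbourhoods.
  Either some \<open>x\<close> keeps almost the full codegree in both colours with many
  \<open>y\<close>, and may join a clique in either colour, or one colour has many \<open>y\<close>
  of excess codegree, and its density rises.\<close>

lemma density_increment:
  fixes E :: "nat \<Rightarrow> nat \<Rightarrow> bool" and Y :: "bool \<Rightarrow> nat set" and d \<alpha> :: "bool \<Rightarrow> real"
  assumes X: "finite X" "X \<noteq> {}" and Y: "\<And>c. finite (Y c)" "\<And>c. Y c \<noteq> {}"
    and d: "\<And>c. 0 < d c" and \<alpha>: "\<And>c. 0 < \<alpha> c" "\<And>c. 1 / \<alpha> c \<le> M"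
    and L: "0 \<le> L" "L \<le> M"
    and deg: "\<And>c x. x \<in> X \<Longrightarrow> d c * card (Y c) \<le> card (nbr E c x \<inter> Y c)"
  shows "(\<exists>x\<in>X. \<exists>X'\<subseteq>X. \<exists>Y'. exp (- 2 * sqrt L) / 26 * card X \<le> card X' \<and>
      (\<forall>c. Y' c \<subseteq> nbr E c x \<inter> Y c \<and> d c * card (Y c) \<le> card (Y' c) \<and>
        (\<forall>y\<in>X'. (d c - 4 * \<alpha> c) * card (Y' c) \<le> card (nbr E c y \<inter> Y' c)))) \<or>
    (\<exists>c. \<exists>X'\<subseteq>X. \<exists>Y'\<subseteq>Y c. exp (- 2 * sqrt M) / 52 * card X \<le> card X' \<and>
      d c * card (Y c) \<le> card Y' \<and>
      (\<forall>y\<in>X'. (d c + L * \<alpha> c) * card Y' \<le> card (nbr E c y \<inter> Y')))"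
proof -
  \<comment> \<open>Neighbourhoods are trimmed to a common size so that one centring constant serves
    all vertices. Rounding up only raises the density: \<open>d c \<le> D c\<close>.\<close>
  define n where "n c = nat \<lceil>d c * card (Y c)\<rceil>" for c
  define D where "D c = n c / card (Y c)" for c
  have Ypos: "0 < card (Y c)" for c using Y by (simp add: card_gt_0_iff)
  have dY: "0 < d c * card (Y c)" for c using Ypos d by simp
  have n_ge: "d c * card (Y c) \<le> n c" for c unfolding n_def by linarith
  have npos: "0 < real (n c)" for c using n_ge dY by (rule less_le_trans[rotated])
  have D_ge: "d c \<le> D c" for c
    using n_ge[of c] Ypos[of c] by (simp add: D_def pos_le_divide_eq)
  have "\<exists>P. P \<subseteq> nbr E c x \<inter> Y c \<and> card P = n c" if "x \<in> X" for c x
  proof -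
    have "n c \<le> card (nbr E c x \<inter> Y c)"
      unfolding n_def using deg[OF that, of c] by linarith
    then show ?thesis by (metis obtain_subset_with_card_n)
  qed
  then have "\<exists>P. \<forall>c. \<forall>x\<in>X. P c x \<subseteq> nbr E c x \<inter> Y c \<and> card (P c x) = n c"
    by (intro choice allI bchoice) blast
  then obtain P where P: "\<And>c x. x \<in> X \<Longrightarrow> P c x \<subseteq> nbr E c x \<inter> Y c" "\<And>c x. x \<in> X \<Longrightarrow> card (P c x) = n c"
    by blast
  have finP: "finite (P c x)" if "x \<in> X" for c x
    using P(1)[OF that, of c] Y(1)[of c] by (meson finite_subset le_infE)
  \<comment> \<open>With this scaling a value \<open>b\<close> of the kernel means codegree density \<open>D c + b * \<alpha> c\<close>.\<close>
  define s where "s c v x = (of_bool (v \<in> P c x) - D c) / sqrt (\<alpha> c * n c)" for c v x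
  define Z where "Z c = gram (Y c) (s c)" for c
  have Zeq: "Z c x y = (card (P c x \<inter> P c y) - D c * n c) / (\<alpha> c * n c)" if "x \<in> X" "y \<in> X" for c x y
  proof -
    have "Z c x y = (\<Sum>v\<in>Y c. (of_bool (v \<in> P c x) - D c) * (of_bool (v \<in> P c y) - D c)) / (\<alpha> c * n c)"
      using \<alpha>(1)[of c] by (simp add: Z_def gram_def s_def sum_divide_distrib power2_eq_square[symmetric] abs_mult)
    also have "(\<Sum>v\<in>Y c. (of_bool (v \<in> P c x) - D c) * (of_bool (v \<in> P c y) - D c))
        = card (P c x \<inter> P c y) - D c * n c"
      unfolding D_def using P that Y by (intro centred_inner_product) auto
    finally show ?thesis .
  qed
  have inter: "(d c + b * \<alpha> c) * card (P c x) \<le> card (nbr E c y \<inter> P c x)"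
    if xy: "x \<in> X" "y \<in> X" and b: "b \<le> Z c x y" for b c x y
  proof -
    have "b * (\<alpha> c * n c) \<le> card (P c x \<inter> P c y) - D c * n c"
      using b Zeq[OF xy, of c] \<alpha>(1)[of c] npos[of c] by (simp add: pos_le_divide_eq)
    moreover have "d c * n c \<le> D c * n c" using D_ge[of c] by (intro mult_right_mono) auto
    moreover have "card (P c x \<inter> P c y) \<le> card (nbr E c y \<inter> P c x)"
      using P(1)[OF xy(2), of c] finP[OF xy(1), of c] by (intro card_mono) auto
    ultimately show ?thesis using P(2)[OF xy(1), of c] by (simp add: algebra_simps)
  qed
  \<comment> \<open>A codegree is at most \<open>n c\<close>, which the scaling turns into
    \<open>1 / \<alpha> c\<close>.\<close>
  have le: "Z c x y \<le> M" if xy: "x \<in> X" "y \<in> X" for c x y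
  proof -
    have "card (P c x \<inter> P c y) \<le> n c"
      using P(2)[OF xy(1), of c] finP[OF xy(1), of c] by (metis Int_lower1 card_mono)
    moreover have "0 \<le> D c * n c" by (simp add: D_def)
    ultimately have "Z c x y \<le> n c / (\<alpha> c * n c)"
      unfolding Zeq[OF xy] using \<alpha>(1)[of c] npos[of c] by (intro divide_right_mono) auto
    also have "\<dots> = 1 / \<alpha> c" using npos[of c] by simp
    finally show ?thesis using \<alpha>(2)[of c] by simp
  qed
  have "(\<exists>x\<in>X. exp (- 2 * sqrt L) / 26 * card X \<le> card {y \<in> X. \<forall>c. - 4 < Z c x y}) \<or>
    (\<exists>c. \<exists>x\<in>X. exp (- 2 * sqrt M) / 52 * card X \<le> card {y \<in> X. L \<le> Z c x y \<and> (\<forall>c'. - 4 < Z c' x y)})"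
    by (rule gram_dichotomy[OF X, of Y s M L, folded Z_def]) (use le L in auto)
  then show ?thesis
  proof (elim disjE exE bexE)
    fix x assume x: "x \<in> X" "exp (- 2 * sqrt L) / 26 * card X \<le> card {y \<in> X. \<forall>c. - 4 < Z c x y}"
    show ?thesis
    proof (intro disjI1 bexI exI conjI allI ballI)
      show "exp (- 2 * sqrt L) / 26 * card X \<le> card {y \<in> X. \<forall>c. - 4 < Z c x y}" by fact
      show "P c x \<subseteq> nbr E c x \<inter> Y c" for c by (rule P(1)[OF x(1)])
      show "d c * card (Y c) \<le> card (P c x)" for c using n_ge P(2)[OF x(1)] by simp
      show "(d c - 4 * \<alpha> c) * card (P c x) \<le> card (nbr E c y \<inter> P c x)"
        if "y \<in> {y \<in> X. \<forall>c. - 4 < Z c x y}" for c y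
        using inter[OF x(1), of y "-4" c] that by (auto intro: less_imp_le)
    qed (use x in auto)
  next
    fix c x assume x: "x \<in> X" "exp (- 2 * sqrt M) / 52 * card X \<le> card {y \<in> X. L \<le> Z c x y \<and> (\<forall>c'. - 4 < Z c' x y)}"
    show ?thesis
    proof (intro disjI2 exI conjI ballI)
      show "exp (- 2 * sqrt M) / 52 * card X \<le> card {y \<in> X. L \<le> Z c x y \<and> (\<forall>c'. - 4 < Z c' x y)}" by fact
      show "P c x \<subseteq> Y c" using P(1)[OF x(1)] by auto
      show "d c * card (Y c) \<le> card (P c x)" using n_ge P(2)[OF x(1)] by simp
      show "(d c + L * \<alpha> c) * card (P c x) \<le> card (nbr E c y \<inter> P c x)"
        if "y \<in> {y \<in> X. L \<le> Z c x y \<and> (\<forall>c'. - 4 < Z c' x y)}" for y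
        using inter[OF x(1), of y L c] that by auto
    qed auto
  qed
qed

lemma mono_clique_insert:
  assumes "\<And>x y. E x y = E y x" "mono_clique E c T" "T \<subseteq> nbr E c x"
  shows "mono_clique E c (insert x T)"
  using assms by (auto simp: mono_clique_def nbr_def)

text \<open>Here \<open>a c\<close> counts the vertices still to be added to the clique of colour \<open>c\<close>, \<open>b c\<close> the density
  increments still allowed, and \<open>e c\<close> is the excess of the density over its floor \<open>f c\<close>. Adding a vertex
  costs a factor \<open>\<theta>\<close> of excess and an increment gains a factor \<open>g\<close>; as a density cannot exceed 1,
  the second condition on \<open>e\<close> guarantees that \<open>b c\<close> is positive whenever an increment occurs.\<close>

lemma monochromatic_book:
  fixes E :: "nat \<Rightarrow> nat \<Rightarrow> bool" and Y :: "bool \<Rightarrow> nat set" and f e m :: "bool \<Rightarrow> real"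
    and a b :: "bool \<Rightarrow> nat" and t L A0 \<theta> g M xc xb :: real
  defines "\<theta> \<equiv> 1 - 1 / t" and "g \<equiv> 1 + L / (4 * t)" and "M \<equiv> 4 * t / A0"
    and "xc \<equiv> exp (- 2 * sqrt L) / 104" and "xb \<equiv> exp (- 2 * sqrt M) / 52"
  assumes sym: "\<And>x y. E x y = E y x"
    and t: "1 < t" and A0: "0 < A0" and L: "0 \<le> L" "L \<le> M"
    and f: "\<And>c. 0 < f c" "\<And>c. f c \<le> 1" and m: "\<And>c. 0 < m c"
    and X: "finite X" and Y: "\<And>c. finite (Y c)"
    and deg: "\<And>c x. x \<in> X \<Longrightarrow> (f c + e c) * card (Y c) \<le> card (nbr E c x \<inter> Y c)"
    and e: "\<And>c. A0 \<le> e c * \<theta> ^ a c" "\<And>c. 1 \<le> e c * \<theta> ^ a c * g ^ b c"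
    and Ysize: "\<And>c. m c \<le> card (Y c) * f c ^ (a c + b c)"
    and Xsize: "1 \<le> card X * xc ^ (a True + a False) * xb ^ (b True + b False)"
  shows "\<exists>c. \<exists>T\<subseteq>X. \<exists>Y'\<subseteq>Y c. card T = a c \<and> mono_clique E c T \<and> (\<forall>x\<in>T. Y' \<subseteq> nbr E c x) \<and> m c \<le> card Y'"
  using X Y deg e Ysize Xsize
proof (induction "a True + a False + (b True + b False)" arbitrary: X Y e a b rule: less_induct)
  case less
  note X = less.prems(1) and Y = less.prems(2) and deg = less.prems(3) and eA = less.prems(4) and e1 = less.prems(5)
    and Ysize = less.prems(6) and Xsize = less.prems(7)
  have th: "0 < \<theta>" "\<theta> < 1" using t by (auto simp: \<theta>_def)
  have Mpos: "0 \<le> M" using t A0 by (simp add: M_def)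
  have "exp (- 2 * sqrt L) \<le> 1" "exp (- 2 * sqrt M) \<le> 1" using L Mpos by simp_all
  then have "xc \<le> 1" "xb \<le> 1"
    unfolding xc_def xb_def by linarith+
  moreover have "0 < xc" "0 < xb" by (simp_all add: xc_def xb_def)
  ultimately have xcb: "0 < xc" "xc \<le> 1" "0 < xb" "xb \<le> 1" by blast+
  show ?case
  proof (cases "\<exists>c. a c = 0")
    case True
    \<comment> \<open>Nothing remains to be added in colour \<open>c\<close>: the empty clique with
      \<open>Y c\<close> itself is a book.\<close>
    then obtain c where c: "a c = 0" by blast
    have "card (Y c) * f c ^ (a c + b c) \<le> real (card (Y c)) * 1"
      using f[of c] by (intro mult_left_mono power_le_one) auto
    then have "m c \<le> card (Y c)" using Ysize[of c] by linarith
    then show ?thesis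
      by (intro exI[of _ c] exI[of _ "{}"]) (auto simp: c mono_clique_def)
  next
    case False
    then have apos: "0 < a c" for c by simp
    have Xne: "X \<noteq> {}" using Xsize by auto
    have Yne: "Y c \<noteq> {}" for c
      using Ysize[of c] m[of c] by auto
    have e_ge: "e c * \<theta> ^ a c \<le> e c" "A0 \<le> e c" for c
    proof -
      have "0 < e c * \<theta> ^ a c" using eA[of c] A0 by linarith
      then have "0 < e c" using th by (simp add: zero_less_mult_iff)
      then show "e c * \<theta> ^ a c \<le> e c" using th by (intro mult_left_le power_le_one) auto
      then show "A0 \<le> e c" using eA[of c] by linarith
    qed
    have epos: "0 < e c" for c using e_ge(2)[of c] A0 by linarith
    \<comment> \<open>With this scale the loss of \<open>4 * \<alpha> c\<close> is a fraction
      \<open>1 / t\<close> of the excess, leaving the factor \<theta>, and a gain of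
      \<open>L * \<alpha> c\<close> is the factor \<open>g\<close>.\<close>
    define \<alpha> where "\<alpha> c = e c / (4 * t)" for c
    have \<alpha>: "0 < \<alpha> c" "1 / \<alpha> c \<le> M" for c
      using epos[of c] e_ge(2)[of c] t A0 by (auto simp: \<alpha>_def M_def intro!: divide_left_mono)
    have new_c: "f c + e c - 4 * \<alpha> c = f c + e c * \<theta>" for c
      using t by (simp add: \<alpha>_def \<theta>_def field_simps)
    have new_b: "f c + e c + L * \<alpha> c = f c + e c * g" for c
      using t by (simp add: \<alpha>_def g_def field_simps)
    have fe: "0 < f c + e c" for c using f[of c] epos[of c] by linarith
    \<comment> \<open>Either kind of step keeps at least a fraction \<open>f c\<close> of
      \<open>Y c\<close> and lowers \<open>a c + b c\<close> by one, so the size invariant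
      survives.\<close>
    have Yshrink: "m c \<le> card Y' * f c ^ (a c + b c - 1)" if "(f c + e c) * card (Y c) \<le> card Y'" for c Y'
    proof -
      have "f c * card (Y c) \<le> (f c + e c) * card (Y c)"
        using epos[of c] by (intro mult_right_mono) auto
      then have "f c * card (Y c) * f c ^ (a c + b c - 1) \<le> card Y' * f c ^ (a c + b c - 1)"
        using that f(1)[of c] by (intro mult_right_mono) auto
      moreover have "f c * f c ^ (a c + b c - 1) = f c ^ (a c + b c)"
        using apos[of c] by (metis power_minus_mult add_gr_0 mult.commute)
      ultimately show ?thesis
        using Ysize[of c] by (metis mult.assoc mult.commute order_trans)
    qed
    have "(\<exists>x\<in>X. \<exists>X'\<subseteq>X. \<exists>Y'. exp (- 2 * sqrt L) / 26 * card X \<le> card X' \<and>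
        (\<forall>c. Y' c \<subseteq> nbr E c x \<inter> Y c \<and> (f c + e c) * card (Y c) \<le> card (Y' c) \<and>
          (\<forall>y\<in>X'. (f c + e c - 4 * \<alpha> c) * card (Y' c) \<le> card (nbr E c y \<inter> Y' c)))) \<or>
      (\<exists>c. \<exists>X'\<subseteq>X. \<exists>Y'\<subseteq>Y c. exp (- 2 * sqrt M) / 52 * card X \<le> card X' \<and>
        (f c + e c) * card (Y c) \<le> card Y' \<and>
        (\<forall>y\<in>X'. (f c + e c + L * \<alpha> c) * card Y' \<le> card (nbr E c y \<inter> Y')))"
      by (rule density_increment[OF X Xne Y Yne fe \<alpha> L]) (rule deg)
    then show ?thesis
    proof (elim disjE exE bexE conjE)
      fix x X' Y'
      assume x: "x \<in> X" and X': "X' \<subseteq> X" "exp (- 2 * sqrt L) / 26 * card X \<le> card X'"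
        and Y': "\<forall>c. Y' c \<subseteq> nbr E c x \<inter> Y c \<and> (f c + e c) * card (Y c) \<le> card (Y' c) \<and>
            (\<forall>y\<in>X'. (f c + e c - 4 * \<alpha> c) * card (Y' c) \<le> card (nbr E c y \<inter> Y' c))"
      define a' where "a' = a True + a False - 1"
      have a': "a True + a False = Suc a'" using apos[of True] by (simp add: a'_def)
      have finX': "finite X'" using X' X finite_subset by blast
      \<comment> \<open>The 104 in \<open>xc\<close> is 4 times 26. The spare factor 4 pays for
        removing \<open>x\<close> and for passing to its majority colour in \<open>X'\<close>; since
        \<open>X'\<close> has at least 4 elements, half of the rest is at least a quarter.\<close>
      have X'4: "4 * (xc * card X) \<le> card X'" using X'(2) by (simp add: xc_def mult.commute)
      have "card X * xc ^ (a True + a False) * xb ^ (b True + b False) \<le> card X * xc * 1"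
        unfolding a' power_Suc mult.assoc[symmetric]
        using xcb by (intro mult_mono mult_left_le power_le_one) (auto intro!: mult_nonneg_nonneg)
      then have "1 \<le> xc * card X" using Xsize by (simp add: mult.commute)
      then have X'ge4: "4 \<le> real (card X')" using X'4 by linarith
      have "X' - {x} = (nbr E True x \<inter> X') \<union> (nbr E False x \<inter> X')" by (auto simp: nbr_def)
      then have "card (X' - {x}) \<le> card (nbr E True x \<inter> X') + card (nbr E False x \<inter> X')"
        by (metis card_Un_le)
      then have "card X' - 1 \<le> card (nbr E True x \<inter> X') + card (nbr E False x \<inter> X')"
        by (metis card_Diff_singleton_if diff_le_self le_trans diff_le_mono order.refl)
      then have "card X' - 1 \<le> 2 * card (nbr E True x \<inter> X') \<or> card X' - 1 \<le> 2 * card (nbr E False x \<inter> X')"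
        by linarith
      then obtain c where "card X' - 1 \<le> 2 * card (nbr E c x \<inter> X')" by blast
      then have Xc: "xc * card X \<le> card (nbr E c x \<inter> X')"
        using X'4 X'ge4 by linarith
      define W where "W = nbr E c x \<inter> X'"
      \<comment> \<open>Only the majority colour moves to its new \<open>Y' c\<close>; the other
        colour keeps its set, excess and counters.\<close>
      have "\<exists>ca. \<exists>T\<subseteq>W. \<exists>V\<subseteq>(Y(c := Y' c)) ca. card T = (a(c := a c - 1)) ca \<and> mono_clique E ca T \<and>
          (\<forall>x\<in>T. V \<subseteq> nbr E ca x) \<and> m ca \<le> card V"
      proof (rule less.hyps[where e = "e(c := e c * \<theta>)" and b = b])
        show "(a(c := a c - 1)) True + (a(c := a c - 1)) False + (b True + b False)
            < a True + a False + (b True + b False)"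
          using apos[of c] by (cases c) auto
        show "finite W" using finX' by (simp add: W_def)
        have "finite (Y' c)" using Y' Y[of c] by (meson finite_subset le_infE)
        then show "finite ((Y(c := Y' c)) ca)" for ca
          using Y[of ca] by (metis fun_upd_apply)
        show "(f ca + (e(c := e c * \<theta>)) ca) * card ((Y(c := Y' c)) ca) \<le> card (nbr E ca y \<inter> (Y(c := Y' c)) ca)"
          if "y \<in> W" for ca y
          using that Y'[unfolded new_c] deg X' by (auto simp: W_def)
        have eq: "e c * \<theta> * \<theta> ^ (a c - 1) = e c * \<theta> ^ a c"
          using apos[of c] by (metis power_minus_mult mult.assoc mult.commute)
        show "A0 \<le> (e(c := e c * \<theta>)) ca * \<theta> ^ (a(c := a c - 1)) ca"
          "1 \<le> (e(c := e c * \<theta>)) ca * \<theta> ^ (a(c := a c - 1)) ca * g ^ b ca" for ca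
          using eA[of ca] e1[of ca] by (auto simp only: fun_upd_apply eq split: if_split)
        show "m ca \<le> card ((Y(c := Y' c)) ca) * f ca ^ ((a(c := a c - 1)) ca + b ca)" for ca
          using Yshrink[of c "Y' c"] Y' Ysize[of ca] apos[of c] by (auto simp: Nat.add_diff_assoc2)
        have "card X * xc ^ (a True + a False) * xb ^ (b True + b False) = (xc * card X) * xc ^ a' * xb ^ (b True + b False)"
          by (simp add: a' mult_ac)
        also have "\<dots> \<le> card W * xc ^ a' * xb ^ (b True + b False)"
          using Xc xcb by (intro mult_right_mono) (auto simp: W_def)
        also have "a' = (a(c := a c - 1)) True + (a(c := a c - 1)) False"
          using apos[of c] by (cases c) (auto simp: a'_def)
        finally show "1 \<le> card W * xc ^ ((a(c := a c - 1)) True + (a(c := a c - 1)) False) * xb ^ (b True + b False)"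
          using Xsize by linarith
      qed
      then obtain ca T V where T: "T \<subseteq> W" "V \<subseteq> (Y(c := Y' c)) ca" "card T = (a(c := a c - 1)) ca"
        "mono_clique E ca T" "\<forall>x\<in>T. V \<subseteq> nbr E ca x" "m ca \<le> card V" by blast
      \<comment> \<open>A book of colour \<open>c\<close> gains \<open>x\<close>, since both
        \<open>T\<close> and \<open>V\<close> lie in its neighbourhood. A book of the other colour
        is returned unchanged.\<close>
      show ?thesis
      proof (cases "ca = c")
        case True
        have "x \<notin> T" "T \<subseteq> nbr E c x" using T(1) by (auto simp: W_def nbr_def)
        moreover have "finite T" using T(1) finX' by (auto simp: W_def intro: finite_subset)
        ultimately have "card (insert x T) = a c" "mono_clique E c (insert x T)"
          using T(3,4) True apos[of c] mono_clique_insert[OF sym] by auto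
        moreover have "V \<subseteq> Y c" "V \<subseteq> nbr E c x"
          using T(2) Y'[THEN spec, of c] unfolding True fun_upd_same by blast+
        ultimately show ?thesis
          using T True x X' by (intro exI[of _ c] exI[of _ "insert x T"] exI[of _ V]) (auto simp: W_def)
      next
        case False
        then show ?thesis
          using T X' by (intro exI[of _ ca] exI[of _ T] exI[of _ V]) (auto simp: W_def)
      qed
    next
      fix c X' Y'
      assume X': "X' \<subseteq> X" "exp (- 2 * sqrt M) / 52 * card X \<le> card X'"
        and Y': "Y' \<subseteq> Y c" "(f c + e c) * card (Y c) \<le> card Y'"
          "\<forall>y\<in>X'. (f c + e c + L * \<alpha> c) * card Y' \<le> card (nbr E c y \<inter> Y')"
      have bpos: "0 < b c"
      proof (rule ccontr)
        assume "\<not> 0 < b c"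
        then have "1 \<le> e c" using e1[of c] e_ge(1)[of c] by simp
        then have "1 * real (card (Y c)) < (f c + e c) * card (Y c)"
          using f(1)[of c] Y[of c] Yne[of c] by (intro mult_strict_right_mono) (auto simp: card_gt_0_iff)
        also obtain x where "x \<in> X" using Xne by blast
        then have "(f c + e c) * card (Y c) \<le> card (nbr E c x \<inter> Y c)" by (rule deg)
        also have "\<dots> \<le> card (Y c)" using Y[of c] by (simp add: card_mono)
        finally show False by simp
      qed
      define b' where "b' = b True + b False - 1"
      have b': "b True + b False = Suc b'" using bpos by (cases c) (auto simp: b'_def)
      have "\<exists>ca. \<exists>T\<subseteq>X'. \<exists>V\<subseteq>(Y(c := Y')) ca. card T = a ca \<and> mono_clique E ca T \<and>
          (\<forall>x\<in>T. V \<subseteq> nbr E ca x) \<and> m ca \<le> card V"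
      proof (rule less.hyps[where e = "e(c := e c * g)" and b = "b(c := b c - 1)"])
        show "a True + a False + ((b(c := b c - 1)) True + (b(c := b c - 1)) False)
            < a True + a False + (b True + b False)"
          using bpos by (cases c) auto
        show "finite X'" using X' X finite_subset by blast
        have "finite Y'" using Y' Y[of c] by (meson finite_subset)
        then show "finite ((Y(c := Y')) ca)" for ca
          using Y[of ca] by (metis fun_upd_apply)
        show "(f ca + (e(c := e c * g)) ca) * card ((Y(c := Y')) ca) \<le> card (nbr E ca y \<inter> (Y(c := Y')) ca)"
          if "y \<in> X'" for ca y
          using that Y'[unfolded new_b] deg X' by auto
        have g: "1 \<le> g" using L t by (simp add: g_def)
        have "e c * \<theta> ^ a c * 1 \<le> e c * \<theta> ^ a c * g"
          using g epos[of c] th by (intro mult_left_mono) auto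
        then show "A0 \<le> (e(c := e c * g)) ca * \<theta> ^ a ca" for ca
          using eA[of ca] by (auto simp: mult_ac)
        have eq: "e c * g * \<theta> ^ a c * g ^ (b c - 1) = e c * \<theta> ^ a c * g ^ b c"
          using power_minus_mult[OF bpos, of g] by (simp add: mult_ac)
        show "1 \<le> (e(c := e c * g)) ca * \<theta> ^ a ca * g ^ (b(c := b c - 1)) ca" for ca
          using e1[of ca] by (cases "ca = c") (simp_all only: fun_upd_apply eq if_True if_False refl)
        show "m ca \<le> card ((Y(c := Y')) ca) * f ca ^ (a ca + (b(c := b c - 1)) ca)" for ca
          using Yshrink[of c Y'] Y' Ysize[of ca] bpos by auto
        have "card X * xc ^ (a True + a False) * xb ^ (b True + b False) = (xb * card X) * xc ^ (a True + a False) * xb ^ b'"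
          by (simp add: b' mult_ac)
        also have "\<dots> \<le> card X' * xc ^ (a True + a False) * xb ^ b'"
          using X' xcb by (intro mult_right_mono) (auto simp: xb_def)
        also have "b' = (b(c := b c - 1)) True + (b(c := b c - 1)) False"
          using bpos by (cases c) (auto simp: b'_def)
        finally show "1 \<le> card X' * xc ^ (a True + a False) * xb ^ ((b(c := b c - 1)) True + (b(c := b c - 1)) False)"
          using Xsize by linarith
      qed
      then obtain ca T V where T: "T \<subseteq> X'" "V \<subseteq> (Y(c := Y')) ca" "card T = a ca"
        "mono_clique E ca T" "\<forall>x\<in>T. V \<subseteq> nbr E ca x" "m ca \<le> card V" by blast
      moreover have "V \<subseteq> Y ca" using T(2) Y'(1) by (cases "ca = c") auto
      ultimately show ?thesis
        using X'(1) by (intro exI[of _ ca] exI[of _ T] exI[of _ V]) auto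
    qed
  qed
qed

section \<open>Regularisation\<close>

text \<open>Colour-indexed parameters: \<open>h True\<close> and \<open>h False\<close> play the roles of \<open>k\<close> and \<open>l\<close>.\<close>

definition has_mono :: "(nat \<Rightarrow> nat \<Rightarrow> bool) \<Rightarrow> (bool \<Rightarrow> nat) \<Rightarrow> nat set \<Rightarrow> bool" where
  "has_mono E h V \<longleftrightarrow> (\<exists>c. \<exists>K\<subseteq>V. card K = h c + 1 \<and> mono_clique E c K)"

definition bino :: "(bool \<Rightarrow> nat) \<Rightarrow> nat" where
  "bino h = (h True + h False) choose h True"

definition share :: "(bool \<Rightarrow> nat) \<Rightarrow> bool \<Rightarrow> real" where
  "share h c = real (h c) / (real (h c) + real (h (\<not> c)))"

lemma bino_pos: "0 < bino h"
  by (simp add: bino_def)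

lemma bino_alt: "bino h = (h c + h (\<not> c)) choose h c"
  by (cases c) (simp_all add: bino_def binomial_symmetric[of "h True"] add.commute)

lemma bino_decrease:
  assumes "0 < h c"
  shows "real (bino (h(c := h c - 1))) = bino h * share h c"
proof -
  obtain j where j: "h c = Suc j" using assms by (cases "h c") auto
  have "Suc j * (Suc (j + h (\<not> c)) choose Suc j) = Suc (j + h (\<not> c)) * (j + h (\<not> c) choose j)"
    by (metis Suc_times_binomial_eq mult.commute)
  then have "real (Suc j) * real (Suc (j + h (\<not> c)) choose Suc j)
      = real (Suc (j + h (\<not> c))) * real (j + h (\<not> c) choose j)"
    by (metis of_nat_mult)
  moreover have "bino (h(c := h c - 1)) = (j + h (\<not> c)) choose j"
    using j by (simp add: bino_alt[of _ c])
  moreover have "bino h = Suc (j + h (\<not> c)) choose Suc j"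
    using j by (simp add: bino_alt[of _ c])
  ultimately show ?thesis using j by (simp add: share_def field_simps)
qed

lemma bino_pascal:
  assumes "\<And>c. 0 < h c"
  shows "bino h = bino (h(True := h True - 1)) + bino (h(False := h False - 1))"
proof -
  obtain i j where "h True = Suc i" "h False = Suc j"
    using assms by (metis Suc_pred)
  then show ?thesis by (simp add: bino_def)
qed

lemma has_mono_extend:
  assumes sym: "\<And>x y. E x y = E y x" and V: "finite V" "T \<subseteq> V" "U \<subseteq> V"
    and T: "mono_clique E c T" "\<And>x. x \<in> T \<Longrightarrow> U \<subseteq> nbr E c x" "card T \<le> h c"
    and U: "has_mono E (h(c := h c - card T)) U"
  shows "has_mono E h V"
proof -
  obtain c' K where K: "K \<subseteq> U" "card K = (h(c := h c - card T)) c' + 1" "mono_clique E c' K"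
    using U unfolding has_mono_def by blast
  show ?thesis
  proof (cases "c' = c")
    case True
    have "T \<inter> K = {}" using T(2) K(1) by (auto simp: nbr_def)
    moreover have "finite T" "finite K" using V K by (auto dest: finite_subset)
    ultimately have "card (T \<union> K) = h c + 1"
      using K(2) T(3) True by (simp add: card_Un_disjoint)
    moreover have "mono_clique E c (T \<union> K)"
      unfolding mono_clique_def
    proof (intro ballI impI)
      have TK: "E x y = c" "E y x = c" if "x \<in> T" "y \<in> K" for x y
        using T(2)[OF that(1)] K(1) that(2) sym[of y x] by (auto simp: nbr_def)
      show "E x y = c" if "x \<in> T \<union> K" "y \<in> T \<union> K" "x \<noteq> y" for x y
        using that T(1) K(3) TK unfolding True mono_clique_def by (metis UnE)
    qed
    ultimately show ?thesis
      using V K unfolding has_mono_def by (intro exI[of _ c] exI[of _ "T \<union> K"]) blast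
  next
    case False
    then have "card K = h c' + 1" using K(2) by simp
    then show ?thesis
      using V K unfolding has_mono_def by blast
  qed
qed

lemma has_mono_extend_vertex:
  assumes "\<And>x y. E x y = E y x" "finite V" "x \<in> V" "0 < h c"
    and "has_mono E (h(c := h c - 1)) (nbr E c x \<inter> V)"
  shows "has_mono E h V"
  using assms by (intro has_mono_extend[of E V "{x}" "nbr E c x \<inter> V" c h]) (auto simp: mono_clique_def)

lemma has_mono_trivial:
  assumes "V \<noteq> {}" "h c = 0" shows "has_mono E h V"
proof -
  obtain v where "v \<in> V" using assms by blast
  then show ?thesis
    using assms unfolding has_mono_def by (intro exI[of _ c] exI[of _ "{v}"]) (auto simp: mono_clique_def)
qed

lemma card_nbr_sum:
  assumes "finite V" "x \<in> V"
  shows "card (nbr E c x \<inter> V) + card (nbr E (\<not> c) x \<inter> V) + 1 = card V"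
proof -
  have "V = insert x ((nbr E c x \<inter> V) \<union> (nbr E (\<not> c) x \<inter> V))" "x \<notin> nbr E b x" for b
    using assms by (auto simp: nbr_def)
  moreover have "(nbr E c x \<inter> V) \<inter> (nbr E (\<not> c) x \<inter> V) = {}" by (auto simp: nbr_def)
  ultimately show ?thesis
    using assms by (metis (no_types, lifting) IntE Suc_eq_plus1 UnE card_Un_disjoint card_insert_disjoint finite_Int finite_UnI)
qed

text \<open>Pigeonhole against Pascal's rule: if both neighbourhoods of \<open>x\<close> were too
  small, their sizes would sum to at most \<open>bino h - 2\<close>, but they sum to
  \<open>card V - 1\<close>.\<close>

lemma erdos_szekeres:
  assumes sym: "\<And>x y. E x y = E y x"
  shows "finite V \<Longrightarrow> bino h \<le> card V \<Longrightarrow> has_mono E h V"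
proof (induction "h True + h False" arbitrary: h V rule: less_induct)
  case less
  have "V \<noteq> {}" using less.prems bino_pos[of h] by auto
  show ?case
  proof (cases "\<exists>c. h c = 0")
    case True
    then show ?thesis using \<open>V \<noteq> {}\<close> has_mono_trivial by blast
  next
    case False
    then have hpos: "0 < h c" for c by simp
    obtain x where x: "x \<in> V" using \<open>V \<noteq> {}\<close> by blast
    have "\<exists>c. bino (h(c := h c - 1)) \<le> card (nbr E c x \<inter> V)"
    proof (rule ccontr)
      assume "\<not> ?thesis"
      then have "card (nbr E c x \<inter> V) < bino (h(c := h c - 1))" for c by (simp add: not_le)
      from this[of True] this[of False] show False
        using card_nbr_sum[OF less.prems(1) x, of E True] bino_pascal[OF hpos] less.prems(2) by simp
    qed
    then obtain c where "bino (h(c := h c - 1)) \<le> card (nbr E c x \<inter> V)" by blast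
    moreover have "(h(c := h c - 1)) True + (h(c := h c - 1)) False < h True + h False"
      using hpos[of c] by (cases c) auto
    ultimately have "has_mono E (h(c := h c - 1)) (nbr E c x \<inter> V)"
      using less by simp
    then show ?thesis
      by (rule has_mono_extend_vertex[of E V x h c, OF sym less.prems(1) x hpos])
  qed
qed

text \<open>Lowering \<open>h c\<close> by one multiplies \<open>bino h\<close> by exactly
  \<open>share h c\<close>. Entering a neighbourhood of relative size at least
  \<open>(1 + \<gamma>) * share h c\<close> therefore removes one power of
  \<open>1 + \<gamma>\<close> from the size deficit. After \<open>S\<close> such moves no deficit is
  left and \<open>erdos_szekeres\<close> applies; if the moves stop earlier, the set is
  regular.\<close>

lemma regularize:
  fixes \<gamma> :: real
  assumes sym: "\<And>x y. E x y = E y x" and \<gamma>: "0 < \<gamma>"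
    and regular: "\<And>h V. finite V \<Longrightarrow> (\<And>c. h c \<le> h0 c \<and> h0 c \<le> h c + S) \<Longrightarrow>
      bino h \<le> (1 + \<gamma>) ^ S * card V \<Longrightarrow>
      (\<And>c x. x \<in> V \<Longrightarrow> card (nbr E c x \<inter> V) < (1 + \<gamma>) * share h c * card V) \<Longrightarrow>
      has_mono E h V"
  shows "finite V \<Longrightarrow> s \<le> S \<Longrightarrow> (\<And>c. h c \<le> h0 c \<and> h0 c + s \<le> h c + S) \<Longrightarrow>
      bino h \<le> (1 + \<gamma>) ^ s * card V \<Longrightarrow> has_mono E h V"
proof (induction s arbitrary: h V)
  case 0
  then show ?case using erdos_szekeres[of E, OF sym, of V h] by simp
next
  case (Suc s)
  have "V \<noteq> {}" using Suc.prems(4) bino_pos[of h] by auto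
  show ?case
  proof (cases "\<forall>c. \<forall>x\<in>V. card (nbr E c x \<inter> V) < (1 + \<gamma>) * share h c * card V")
    case True
    show ?thesis
    proof (rule regular[OF Suc.prems(1)])
      show "h c \<le> h0 c \<and> h0 c \<le> h c + S" for c using Suc.prems(3)[of c] by simp
      have "(1 + \<gamma>) ^ Suc s * card V \<le> (1 + \<gamma>) ^ S * card V"
        using \<gamma> Suc.prems(2) by (intro mult_right_mono power_increasing) auto
      then show "bino h \<le> (1 + \<gamma>) ^ S * card V" using Suc.prems(4) by linarith
    qed (use True in auto)
  next
    case False
    then obtain c x where x: "x \<in> V" "(1 + \<gamma>) * share h c * card V \<le> card (nbr E c x \<inter> V)"
      by (auto simp: not_less)
    show ?thesis
    proof (cases "\<exists>c. h c = 0")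
      case True
      then show ?thesis using \<open>V \<noteq> {}\<close> has_mono_trivial by blast
    next
      case False
      then have hpos: "0 < h c" by simp
      have "has_mono E (h(c := h c - 1)) (nbr E c x \<inter> V)"
      proof (rule Suc.IH)
        show "(h(c := h c - 1)) c' \<le> h0 c' \<and> h0 c' + s \<le> (h(c := h c - 1)) c' + S" for c'
          using Suc.prems(3)[of c'] hpos by (cases "c' = c") auto
        have "bino (h(c := h c - 1)) \<le> ((1 + \<gamma>) ^ Suc s * card V) * share h c"
          unfolding bino_decrease[of h c, OF hpos] using Suc.prems(4) by (intro mult_right_mono) (auto simp: share_def)
        also have "\<dots> = (1 + \<gamma>) ^ s * ((1 + \<gamma>) * share h c * card V)"
          by simp
        also have "\<dots> \<le> (1 + \<gamma>) ^ s * card (nbr E c x \<inter> V)"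
          using x(2) \<gamma> by (intro mult_left_mono) auto
        finally show "bino (h(c := h c - 1)) \<le> (1 + \<gamma>) ^ s * card (nbr E c x \<inter> V)" .
      qed (use Suc.prems in auto)
      then show ?thesis by (rule has_mono_extend_vertex[of E V x h c, OF sym Suc.prems(1) x(1) hpos])
    qed
  qed
qed

text \<open>The book is sought with \<open>X\<close> and both sets \<open>Y c\<close> equal to
  \<open>V\<close>, floor \<open>p c - 3 * \<gamma>\<close> and excess \<gamma>. \<open>A0\<close>
  is the excess left after \<open>t\<close> additions without increments, and \<open>boost\<close>
  says that \<open>B\<close> increments would lift it to 1. Erdos-Szekeres then finishes inside the
  common neighbourhood.\<close>

lemma regular_has_mono:
  fixes h :: "bool \<Rightarrow> nat" and \<gamma> L A0 :: real and t B :: nat and p :: "bool \<Rightarrow> real"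
  defines "p \<equiv> share h" and "A0 \<equiv> \<gamma> * (1 - 1 / t) ^ t"
  assumes sym: "\<And>x y. E x y = E y x" and V: "finite V"
    and \<gamma>: "0 < \<gamma>" "\<And>c. 3 * \<gamma> < p c" "1 \<le> \<gamma> * card V"
    and deg: "\<And>c x. x \<in> V \<Longrightarrow> card (nbr E c x \<inter> V) < (1 + \<gamma>) * p c * card V"
    and t: "1 < t" "\<And>c. t \<le> h c" and L: "0 \<le> L" "L \<le> 4 * real t / A0"
    and boost: "1 \<le> A0 * (1 + L / (4 * real t)) ^ B"
    and small: "\<And>c. bino (h(c := h c - t)) \<le> card V * (p c - 3 * \<gamma>) ^ (t + B)"
    and large: "1 \<le> card V * (exp (- 2 * sqrt L) / 104) ^ (t + t) * (exp (- 2 * sqrt (4 * real t / A0)) / 52) ^ (B + B)"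
  shows "has_mono E h V"
proof -
  have p1: "p c \<le> 1" "p (\<not> c) = 1 - p c" for c
    using t(2)[of c] t(1) by (auto simp: p_def share_def field_simps)
  \<comment> \<open>An upper degree bound in one colour is a lower bound in the other: it loses at
    most \<gamma> from regularity, and another \<gamma> covers the missing vertex itself.\<close>
  have deg': "(p c - 3 * \<gamma> + \<gamma>) * card V \<le> card (nbr E c x \<inter> V)" if "x \<in> V" for c x
  proof -
    have "card (nbr E c x \<inter> V) + card (nbr E (\<not> c) x \<inter> V) + 1 = real (card V)"
      using card_nbr_sum[OF V that, of E c] by (metis of_nat_1 of_nat_add)
    moreover have "card (nbr E (\<not> c) x \<inter> V) < (1 + \<gamma>) * (1 - p c) * card V"
      using deg[OF that, of "\<not> c"] p1(2) by simp
    moreover have "0 \<le> \<gamma> * p c * card V" using \<gamma>(1) by (simp add: p_def share_def)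
    ultimately show ?thesis using \<gamma>(3) by (simp add: algebra_simps)
  qed
  have "0 < A0" using \<gamma> t by (simp add: A0_def)
  have f: "0 < p c - 3 * \<gamma>" "p c - 3 * \<gamma> \<le> 1" for c
    using \<gamma>(2)[of c] \<gamma>(1) p1(1)[of c] by linarith+
  have t1: "1 < real t" using t by simp
  have "\<exists>c. \<exists>T\<subseteq>V. \<exists>Y'\<subseteq>V. card T = t \<and> mono_clique E c T \<and> (\<forall>x\<in>T. Y' \<subseteq> nbr E c x) \<and>
      real (bino (h(c := h c - t))) \<le> card Y'"
    by (rule monochromatic_book[where E = E and X = V and Y = "\<lambda>_. V" and f = "\<lambda>c. p c - 3 * \<gamma>" and e = "\<lambda>_. \<gamma>"
        and a = "\<lambda>_. t" and b = "\<lambda>_. B" and t = t and L = L and ?A0.0 = A0 and m = "\<lambda>c. real (bino (h(c := h c - t)))",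
          OF sym t1 \<open>0 < A0\<close> L f _ V V deg' _ _ small large])
      (use boost bino_pos in \<open>auto simp: A0_def\<close>)
  then obtain c T Y' where T: "T \<subseteq> V" "Y' \<subseteq> V" "card T = t" "mono_clique E c T" "\<forall>x\<in>T. Y' \<subseteq> nbr E c x"
      "bino (h(c := h c - t)) \<le> card Y'"
    by auto
  then have "has_mono E (h(c := h c - card T)) Y'"
    using erdos_szekeres[of E, OF sym] finite_subset[OF _ V] by metis
  then show ?thesis
    using T t V by (intro has_mono_extend[of E V T Y' c h, OF sym V T(1,2)]) auto
qed

text \<open>After \<open>t\<close> removals the share has dropped from \<open>k / (k + l)\<close> by
  the factor \<open>1 - l * t / (k * (k + l - t))\<close>, at most
  \<open>exp (- l * t / (k * (k + l)))\<close>. Multiplying these factors sums the numbers below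
  \<open>t\<close>. This drop is the source of the whole improvement.\<close>

lemma bino_decrease_many:
  assumes "t \<le> h c"
  shows "real (bino (h(c := h c - t)))
    \<le> bino h * share h c ^ t * exp (- (h (\<not> c) / (h c * (h c + h (\<not> c))) * (t * (t - 1) / 2)))"
  using assms
proof (induction t)
  case 0
  then show ?case by simp
next
  case (Suc t)
  define k l where "k = h c" and "l = h (\<not> c)"
  have tk: "t < k" "0 < real k - t" using Suc.prems by (auto simp: k_def)
  have k0: "0 < k" "real t < k" using tk by auto
  have "real (bino (h(c := h c - Suc t))) = bino (h(c := h c - t)) * ((k - t) / (real k - t + l))"
    using bino_decrease[of "h(c := h c - t)" c] tk by (simp add: share_def k_def l_def of_nat_diff)
  also have "\<dots> \<le> (bino h * (k / (real k + l)) ^ t * exp (- (l / (k * (real k + l)) * (t * (real t - 1) / 2)))) * 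
      ((k / (real k + l)) * exp (- (l / (k * (real k + l)) * t)))"
  proof (rule mult_mono)
    show "bino (h(c := h c - t)) \<le> bino h * (k / (real k + l)) ^ t * exp (- (l / (k * (real k + l)) * (t * (real t - 1) / 2)))"
      using Suc unfolding share_def k_def l_def by (simp del: fun_upd_apply)
    define u where "u = real k + l - t"
    have u: "0 < u" "0 < real k + l" using tk by (auto simp: u_def)
    have "(k - t) / (real k - t + l) = ((real k + l) * (real k - t)) / ((real k + l) * u)"
    proof -
      have "real k - t + l = u" by (simp add: u_def)
      then show ?thesis using tk u by (simp add: of_nat_diff)
    qed
    also have "(real k + l) * (real k - t) = k * u - l * t"
      by (simp add: u_def algebra_simps)
    also have "(k * u - l * t) / ((real k + l) * u) = k / (real k + l) * (1 - l * t / (k * u))"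
      using k0 u by (simp add: right_diff_distrib diff_divide_distrib)
    also have "\<dots> \<le> k / (real k + l) * (1 - l * t / (k * (real k + l)))"
      using k0 u by (intro mult_left_mono diff_left_mono divide_left_mono mult_left_mono) (auto simp: u_def)
    also have "\<dots> \<le> k / (real k + l) * exp (- (l * t / (k * (real k + l))))"
      using exp_ge_add_one_self[of "- (l * t / (k * (real k + l)))"] by (intro mult_left_mono) auto
    finally show "(k - t) / (real k - t + l) \<le> (k / (real k + l)) * exp (- (l / (k * (real k + l)) * t))"
      by simp
  qed (use tk in auto)
  also have "\<dots> = bino h * (k / (real k + l)) ^ Suc t * exp (- (l / (k * (real k + l)) * (t * (real t - 1) / 2)) + - (l / (k * (real k + l)) * t))"
    unfolding exp_add by simp
  also have "- (l / (k * (real k + l)) * (t * (real t - 1) / 2)) + - (l / (k * (real k + l)) * t)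
      = - (l / (k * (real k + l)) * (real (Suc t) * (real (Suc t) - 1) / 2))"
  proof -
    have "real (Suc t) * (real (Suc t) - 1) / 2 = t * (real t - 1) / 2 + t" by (simp add: field_simps)
    then show ?thesis by (simp only: distrib_left minus_add_distrib)
  qed
  finally show ?case unfolding share_def k_def l_def by (simp del: fun_upd_apply)
qed

section \<open>The balanced range\<close>

lemma one_minus_ge_exp:
  fixes u :: real
  assumes "0 \<le> u" "u \<le> 1 / 2" shows "exp (- (2 * u)) \<le> 1 - u"
proof -
  have "u * u \<le> u * (1 / 2)" using assms by (intro mult_left_mono) auto
  then have "- (2 * u) \<le> - u - 2 * u\<^sup>2" by (simp add: power2_eq_square)
  also have "\<dots> \<le> ln (1 - u)" using assms by (rule ln_one_minus_pos_lower_bound)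
  finally show ?thesis using assms by (simp add: ln_ge_iff)
qed

lemma one_plus_ge_exp:
  fixes u :: real
  assumes "0 \<le> u" "u \<le> 1" shows "exp (u / 2) \<le> 1 + u"
proof -
  have "u * u \<le> u * 1" using assms by (intro mult_left_mono) auto
  then have "1 + u / 2 + (u / 2)\<^sup>2 \<le> 1 + u" using assms by (simp add: power2_eq_square)
  then show ?thesis using exp_bound[of "u / 2"] assms by simp
qed

lemma one_minus_inverse_power_ge:
  assumes "2 \<le> t" shows "1 / 9 \<le> (1 - 1 / real t) ^ t"
proof -
  have "exp (2 * 1 :: real) \<le> 3\<^sup>2"
    unfolding exp_double by (intro power_mono exp_le) auto
  then have "1 / 9 \<le> exp (- 2 :: real)" by (simp add: exp_minus divide_simps)
  also have "\<dots> = exp (- (2 * (1 / real t))) ^ t"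
    using assms by (simp add: exp_of_nat_mult[symmetric])
  also have "\<dots> \<le> (1 - 1 / real t) ^ t"
    using assms by (intro power_mono one_minus_ge_exp) (auto simp: divide_le_eq)
  finally show ?thesis .
qed

text \<open>From \<open>1 / (1 - u) \<ge> exp u\<close> with \<open>u = l / (k + l) \<ge> c0\<close>
  the ratio \<open>(k + l) / k\<close> is at least \<open>exp c0\<close>, and the binomial
  coefficient is at least its \<open>k\<close>-th power, where
  \<open>k \<ge> c0 * x\<close>.\<close>

lemma bino_ge_exp:
  assumes h: "\<And>c. c0 * x \<le> h c" "h True + h False \<le> x" and "0 < c0" "0 < x"
  shows "exp (c0\<^sup>2 * x) \<le> bino h"
proof -
  define k l where "k = real (h True)" and "l = real (h False)"
  have cx: "0 < c0 * x" using assms by simp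
  have kl: "c0 * x \<le> k" "c0 * x \<le> l" "k + l \<le> x" using h by (auto simp: k_def l_def)
  have k0: "0 < k" "0 < l" using kl cx by linarith+
  have "c0 * (k + l) \<le> l" using kl \<open>0 < c0\<close> by (smt (verit) mult_left_mono)
  then have "c0 \<le> l / (k + l)" using k0 by (simp add: pos_le_divide_eq)
  then have "exp c0 \<le> exp (l / (k + l))" by simp
  also have "\<dots> = 1 / exp (- (l / (k + l)))" by (simp add: exp_minus inverse_eq_divide)
  also have "\<dots> \<le> 1 / (1 - l / (k + l))"
    using exp_ge_add_one_self[of "- (l / (k + l))"] k0 by (intro divide_left_mono) auto
  also have "1 - l / (k + l) = k / (k + l)" using k0 by (simp add: field_simps)
  finally have base: "exp c0 \<le> (k + l) / k" by simp
  have "exp (c0\<^sup>2 * x) \<le> exp (k * c0)"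
    using kl(1) \<open>0 < c0\<close> by (simp add: power2_eq_square mult.commute mult.left_commute)
  also have "\<dots> = exp c0 ^ h True" by (simp add: k_def exp_of_nat_mult)
  also have "\<dots> \<le> ((k + l) / k) ^ h True" using base by (intro power_mono) auto
  also have "\<dots> \<le> bino h"
    using binomial_ge_n_over_k_pow_k[of "h True" "h True + h False", where 'a = real] by (simp add: bino_def k_def l_def)
  finally show ?thesis .
qed

lemma sqrt_powr: "sqrt (x powr a) = x powr (a / 2)"
  by (simp add: powr_half_sqrt[symmetric] powr_powr)

text \<open>With \<open>x\<close> of the order of \<open>k + l\<close>, the choice \<open>t = x powr (3 / 4)\<close> yields a gain \<open>exp (c x powr (1 / 2))\<close>,
  which beats the losses from \<open>\<gamma>\<close>, from the density increments and from the earlier regularisation (N5);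
  N6 says that the candidate set for clique vertices survives all steps.\<close>

lemma balanced_regular_case:
  fixes x c0 \<gamma> :: real and h :: "bool \<Rightarrow> nat" and t B :: nat
  defines "\<gamma> \<equiv> x powr (- 1 / 3)" and "t \<equiv> nat \<lceil>x powr (3 / 4)\<rceil>" and "B \<equiv> nat \<lceil>x powr (2 / 5)\<rceil>"
  assumes c0: "0 < c0" and x: "1 \<le> x"
    and N1: "2 \<le> x powr (3 / 4)" and N2: "2 * x powr (3 / 4) \<le> c0 * x"
    and N3: "6 * x powr (- 1 / 3) \<le> c0" and N4: "9 \<le> x powr (- 1 / 3) * exp (x powr (1 / 20) / 16)"
    and N5: "2 * x powr (1 / 15) + 12 * x powr (5 / 12) / c0 + 2 * x powr (2 / 5) * ln (2 / c0)
        \<le> c0 / x * (x powr (3 / 4) * (x powr (3 / 4) - 1) / 2)"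
    and N6: "4 * x powr (3 / 4) * (2 * x powr (1 / 5) + 7) + 4 * x powr (2 / 5) * (18 * x powr (13 / 24) + 7)
        \<le> c0\<^sup>2 * x - 2 * x powr (1 / 15)"
    and N7: "1 \<le> x powr (- 1 / 3) * exp (c0\<^sup>2 * x - 2 * x powr (1 / 15))"
    and N8: "x powr (2 / 5) \<le> x powr (3 / 4)"
    and sym: "\<And>x y. E x y = E y x" and V: "finite V"
    and h: "\<And>c. c0 * x \<le> h c" "h True + h False \<le> x"
    and size: "bino h \<le> (1 + \<gamma>) ^ B * card V"
    and deg: "\<And>c y. y \<in> V \<Longrightarrow> card (nbr E c y \<inter> V) < (1 + \<gamma>) * share h c * card V"
  shows "has_mono E h V"
proof -
  define p where "p = share h"
  define L where "L = x powr (2 / 5)"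
  define A0 where "A0 = \<gamma> * (1 - 1 / t) ^ t"
  have x25: "1 \<le> x powr (2 / 5)" using x by (simp add: ge_one_powr_ge_zero)
  have B: "real B \<le> 2 * x powr (2 / 5)" "x powr (2 / 5) \<le> B" unfolding B_def using x25 by linarith+
  have t: "real t \<le> 2 * x powr (3 / 4)" "x powr (3 / 4) \<le> t" unfolding t_def using N1 by linarith+
  have t2: "2 \<le> t" using t N1 by linarith
  have \<gamma>: "0 < \<gamma>" "6 * \<gamma> \<le> c0" using x N3 by (auto simp: \<gamma>_def)
  have cx: "0 < c0 * x" using c0 x by simp
  have hpos: "0 < real (h c)" for c using h(1)[of c] cx by linarith
  have hsum: "h c + h (\<not> c) \<le> x" for c using h(2) by (cases c) auto
  have hle: "h c \<le> x" for c using hsum[of c] by linarith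
  have pc0: "c0 \<le> p c" for c
  proof -
    have "c0 * (h c + h (\<not> c)) \<le> c0 * x" using hsum[of c] c0 by (intro mult_left_mono) auto
    then have "c0 * (h c + h (\<not> c)) \<le> h c" using h(1)[of c] by linarith
    then show ?thesis using hpos[of c] by (simp add: p_def share_def pos_le_divide_eq add_pos_nonneg)
  qed
  have p1: "p c \<le> 1" for c using hpos[of c] by (simp add: p_def share_def divide_le_eq)
  have c01: "c0 \<le> 1" using pc0[of True] p1[of True] by linarith
  have A0: "\<gamma> / 9 \<le> A0" "A0 \<le> \<gamma>" 
    using one_minus_inverse_power_ge[OF t2] \<gamma> t2 by (auto simp: A0_def mult_left_le power_le_one)
  have \<gamma>1: "\<gamma> \<le> 1" using \<gamma> c01 by linarith
  have A0pos: "0 < A0" using A0 \<gamma> by linarith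
  \<comment> \<open>The exponent is 1/15 = 2/5 - 1/3.\<close>
  have grow: "(1 + \<gamma>) ^ B \<le> exp (2 * x powr (1 / 15))"
  proof -
    have "(1 + \<gamma>) ^ B \<le> exp \<gamma> ^ B" using \<gamma> by (intro power_mono) (auto simp: add.commute)
    also have "\<dots> = exp (B * \<gamma>)" by (simp add: exp_of_nat_mult)
    also have "B * \<gamma> \<le> 2 * x powr (2 / 5) * x powr (- 1 / 3)" using B \<gamma> by (simp add: \<gamma>_def)
    also have "\<dots> = 2 * x powr (1 / 15)" by (simp add: mult.assoc powr_add[symmetric])
    finally show ?thesis by simp
  qed
  have W: "exp (c0\<^sup>2 * x) \<le> bino h" by (rule bino_ge_exp) (use h c0 x in auto)
  have size': "bino h \<le> exp (2 * x powr (1 / 15)) * card V"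
    using size grow by (smt (verit) mult_right_mono of_nat_0_le_iff)
  have n_ge: "exp (c0\<^sup>2 * x - 2 * x powr (1 / 15)) \<le> card V"
    using W size' by (simp add: exp_diff pos_divide_le_eq mult.commute)
  \<comment> \<open>Here 13/12 = 3/4 + 1/3, and 72 is enlarged to the square 81.\<close>
  have M: "sqrt (4 * real t / A0) \<le> 9 * x powr (13 / 24)"
  proof -
    have "4 * real t / A0 \<le> 4 * (2 * x powr (3 / 4)) / (\<gamma> / 9)"
      using t A0 A0pos \<gamma> by (intro frac_le) auto
    also have "\<dots> = 72 * (x powr (3 / 4) * x powr (1 / 3))" using x by (simp add: \<gamma>_def powr_minus_divide)
    also have "\<dots> = 72 * x powr (13 / 12)" by (simp add: powr_add[symmetric])
    also have "\<dots> \<le> 81 * x powr (13 / 12)" by simp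
    finally have "sqrt (4 * real t / A0) \<le> sqrt (81 * x powr (13 / 12))" by simp
    also have "\<dots> = 9 * x powr (13 / 24)"
      by (simp add: real_sqrt_mult sqrt_powr)
    finally show ?thesis .
  qed
  show ?thesis
  proof (rule regular_has_mono[of E, OF sym V, where \<gamma> = \<gamma> and t = t and L = L and B = B, folded A0_def])
    show "0 < \<gamma>" "1 < t" "0 \<le> L" using \<gamma> t2 by (auto simp: L_def)
    show "3 * \<gamma> < share h c" for c
      using pc0[of c] \<gamma> unfolding p_def by linarith
    show "1 \<le> \<gamma> * card V"
      using order_trans[OF N7[folded \<gamma>_def] mult_left_mono[OF n_ge]] \<gamma> by simp
    show "card (nbr E c y \<inter> V) < (1 + \<gamma>) * share h c * card V" if "y \<in> V" for c y
      by (rule deg[OF that])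
    show "t \<le> h c" for c using t(1) N2 h(1)[of c] by linarith
    have "L \<le> t" using N8 t by (simp add: L_def)
    also have "real t * A0 \<le> real t * 4" using A0 \<gamma>1 by (intro mult_left_mono) auto
    then have "real t \<le> 4 * real t / A0" using A0pos by (simp add: pos_le_divide_eq mult.commute)
    finally show "L \<le> 4 * real t / A0" .
    \<comment> \<open>The total gain exponent \<open>B * L / (8 * t)\<close> has order 2/5 + 2/5 -
      3/4 = 1/20, so it outgrows the polynomial factor \<open>9 / \<gamma>\<close> by N4.\<close>
    show "1 \<le> A0 * (1 + L / (4 * real t)) ^ B"
    proof -
      have "x powr (1 / 20) = x powr (2 / 5) * x powr (2 / 5) / x powr (3 / 4)"
        by (simp add: powr_add[symmetric] powr_diff[symmetric])
      also have "\<dots> \<le> B * L / x powr (3 / 4)"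
        using B x by (intro divide_right_mono mult_right_mono) (auto simp: L_def)
      also have "\<dots> \<le> B * L / (t / 2)"
        using t t2 N1 by (intro divide_left_mono mult_pos_pos) (auto simp: L_def)
      finally have "x powr (1 / 20) / 16 \<le> B * (L / (4 * real t) / 2)" by (simp add: mult_ac)
      then have "exp (x powr (1 / 20) / 16) \<le> exp (L / (4 * real t) / 2) ^ B"
        by (simp add: exp_of_nat_mult[symmetric])
      also have "\<dots> \<le> (1 + L / (4 * real t)) ^ B"
        using \<open>L \<le> t\<close> t2 by (intro power_mono one_plus_ge_exp) (auto simp: L_def)
      finally have "\<gamma> / 9 * exp (x powr (1 / 20) / 16) \<le> A0 * (1 + L / (4 * real t)) ^ B"
        using A0 A0pos by (intro mult_mono) auto
      then show ?thesis using N4 by (simp add: \<gamma>_def)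
    qed
    \<comment> \<open>The gain from \<open>bino_decrease_many\<close> has order
      \<open>x powr (1 / 2)\<close>. It must pay for the deficit of \<open>V\<close> (1/15), for
      lowering the floor by \<open>3 * \<gamma>\<close> over \<open>t\<close> steps (5/12), and for
      \<open>B\<close> increments, each costing at most a factor \<open>c0 / 2\<close> of
      \<open>Y\<close> (2/5).\<close>
    show "bino (h(c := h c - t)) \<le> card V * (share h c - 3 * \<gamma>) ^ (t + B)" for c
    proof -
      have tt: "x powr (3 / 4) * (x powr (3 / 4) - 1) / 2 \<le> t * (real t - 1) / 2"
        using t N1 by (intro divide_right_mono mult_mono) auto
      have "real (h c) * real (h c + h (\<not> c)) \<le> x * x"
        using hle[of c] hsum[of c] x by (intro mult_mono) auto
      then have "c0 * x / (x * x) \<le> h (\<not> c) / (real (h c) * real (h c + h (\<not> c)))"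
        using h(1)[of "\<not> c"] hpos[of c] x by (intro frac_le) auto
      then have "c0 / x \<le> h (\<not> c) / (h c * (h c + h (\<not> c)))" using x by simp
      then have "c0 / x * (x powr (3 / 4) * (x powr (3 / 4) - 1) / 2) \<le> h (\<not> c) / (h c * (h c + h (\<not> c))) * (t * (real t - 1) / 2)"
        using tt N1 by (intro mult_mono) auto
      then have ex: "exp (- (h (\<not> c) / (h c * (h c + h (\<not> c))) * (t * (real t - 1) / 2)))
         \<le> exp (- (2 * x powr (1 / 15)) - 12 * x powr (5 / 12) / c0 - 2 * x powr (2 / 5) * ln (2 / c0))"
        using N5 by simp
      have u: "0 \<le> 3 * \<gamma> / p c" "3 * \<gamma> / p c \<le> 1 / 2"
        using pc0[of c] c0 \<gamma> by (auto simp: pos_divide_le_eq)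
      have u3: "3 * \<gamma> / p c \<le> 3 * \<gamma> / c0"
        using pc0[of c] c0 \<gamma> by (intro divide_left_mono) auto
      have shift: "p c * exp (- (6 * \<gamma> / c0)) \<le> p c - 3 * \<gamma>"
      proof -
        have "exp (- (6 * \<gamma> / c0)) \<le> exp (- (2 * (3 * \<gamma> / p c)))" using u3 by simp
        also have "\<dots> \<le> 1 - 3 * \<gamma> / p c" by (rule one_minus_ge_exp) (use u in auto)
        finally have "p c * exp (- (6 * \<gamma> / c0)) \<le> p c * (1 - 3 * \<gamma> / p c)"
          using pc0[of c] c0 by (intro mult_left_mono) auto
        then show ?thesis using pc0[of c] c0 by (simp add: algebra_simps)
      qed
      have "p c ^ t * exp (- (12 * x powr (5 / 12) / c0)) \<le> p c ^ t * exp (- (6 * \<gamma> / c0)) ^ t"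
      proof -
        have "t * \<gamma> \<le> 2 * x powr (3 / 4) * x powr (- 1 / 3)" using t \<gamma> by (simp add: \<gamma>_def)
        also have "\<dots> = 2 * x powr (5 / 12)" by (simp add: mult.assoc powr_add[symmetric])
        finally have "t * (6 * \<gamma> / c0) \<le> 12 * x powr (5 / 12) / c0"
          using c0 by (simp add: pos_le_divide_eq mult.commute)
        then show ?thesis
          using pc0[of c] c0 by (intro mult_left_mono) (auto simp: exp_of_nat_mult[symmetric])
      qed
      also have "\<dots> \<le> (p c - 3 * \<gamma>) ^ t"
        unfolding power_mult_distrib[symmetric] using shift pc0[of c] c0 by (intro power_mono) auto
      finally have p_t: "p c ^ t * exp (- (12 * x powr (5 / 12) / c0)) \<le> (p c - 3 * \<gamma>) ^ t" .
      have "exp (- (2 * x powr (2 / 5) * ln (2 / c0))) \<le> exp (- (B * ln (2 / c0)))"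
        using B(1) c0 c01 by (simp add: mult_right_mono)
      also have "\<dots> = (c0 / 2) ^ B"
        using c0 by (simp add: exp_of_nat_mult exp_minus power_inverse[symmetric])
      also have "\<dots> \<le> (p c - 3 * \<gamma>) ^ B"
        using pc0[of c] c0 \<gamma> by (intro power_mono) auto
      finally have p_B: "exp (- (2 * x powr (2 / 5) * ln (2 / c0))) \<le> (p c - 3 * \<gamma>) ^ B" .
      have "bino (h(c := h c - t)) \<le> bino h * p c ^ t * exp (- (h (\<not> c) / (h c * (h c + h (\<not> c))) * (t * (real t - 1) / 2)))"
        using bino_decrease_many[of t h c] \<open>t \<le> h c\<close> t2 by (simp add: p_def of_nat_diff)
      also have "\<dots> \<le> (exp (2 * x powr (1 / 15)) * card V) * p c ^ t *
         exp (- (2 * x powr (1 / 15)) - 12 * x powr (5 / 12) / c0 - 2 * x powr (2 / 5) * ln (2 / c0))"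
        using size' ex pc0[of c] c0 by (intro mult_mono) auto
      also have "\<dots> = card V * (p c ^ t * (exp (2 * x powr (1 / 15)) *
          exp (- (2 * x powr (1 / 15)) - 12 * x powr (5 / 12) / c0 - 2 * x powr (2 / 5) * ln (2 / c0))))"
        by (simp only: mult_ac)
      also have "exp (2 * x powr (1 / 15)) * exp (- (2 * x powr (1 / 15)) - 12 * x powr (5 / 12) / c0 - 2 * x powr (2 / 5) * ln (2 / c0))
          = exp (- (12 * x powr (5 / 12) / c0)) * exp (- (2 * x powr (2 / 5) * ln (2 / c0)))"
        by (simp add: exp_add[symmetric])
      also have "card V * (p c ^ t * (exp (- (12 * x powr (5 / 12) / c0)) * exp (- (2 * x powr (2 / 5) * ln (2 / c0)))))
          = card V * (p c ^ t * exp (- (12 * x powr (5 / 12) / c0)) * exp (- (2 * x powr (2 / 5) * ln (2 / c0))))"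
        by (simp only: mult.assoc)
      also have "\<dots> \<le> card V * ((p c - 3 * \<gamma>) ^ t * (p c - 3 * \<gamma>) ^ B)"
        using p_t p_B pc0[of c] c0 \<gamma> by (intro mult_left_mono mult_mono) auto
      finally show ?thesis unfolding p_def power_add .
    qed
    show "1 \<le> card V * (exp (- 2 * sqrt L) / 104) ^ (t + t) * (exp (- 2 * sqrt (4 * real t / A0)) / 52) ^ (B + B)"
    proof -
      \<comment> \<open>\<open>exp 7\<close> exceeds 2 to the 7th, which is 128, and so covers both
        104 and 52. In N6 the orders 3/4 + 1/5 and 2/5 + 13/24 are below 1, which is what the slow
        growth of \<open>csq\<close> makes possible.\<close>
      have e7: "104 \<le> exp (7 :: real)"
        using power_mono[of 2 "exp (1 :: real)" 7] exp_ge_add_one_self[of 1] by (simp add: exp_of_nat_mult[symmetric])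
      have "exp (- (4 * x powr (3 / 4) * (2 * x powr (1 / 5) + 7))) \<le> exp (- ((t + t) * (2 * x powr (1 / 5) + 7)))"
        using t by (simp add: mult_right_mono)
      also have "\<dots> = exp (- (2 * x powr (1 / 5)) - 7) ^ (t + t)"
        by (simp add: exp_of_nat_mult[symmetric] algebra_simps)
      also have "\<dots> \<le> (exp (- 2 * sqrt L) / 104) ^ (t + t)"
        unfolding exp_diff using e7 by (intro power_mono frac_le) (auto simp: L_def sqrt_powr)
      finally have l1: "exp (- (4 * x powr (3 / 4) * (2 * x powr (1 / 5) + 7))) \<le> (exp (- 2 * sqrt L) / 104) ^ (t + t)" .
      have "exp (- (4 * x powr (2 / 5) * (18 * x powr (13 / 24) + 7))) \<le> exp (- ((B + B) * (18 * x powr (13 / 24) + 7)))"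
        using B by (simp add: mult_right_mono)
      also have "\<dots> = exp (- (18 * x powr (13 / 24)) - 7) ^ (B + B)"
        by (simp add: exp_of_nat_mult[symmetric] algebra_simps)
      also have "\<dots> \<le> (exp (- 2 * sqrt (4 * real t / A0)) / 52) ^ (B + B)"
        unfolding exp_diff using M e7 by (intro power_mono frac_le) auto
      finally have l2: "exp (- (4 * x powr (2 / 5) * (18 * x powr (13 / 24) + 7))) \<le> (exp (- 2 * sqrt (4 * real t / A0)) / 52) ^ (B + B)" .
      have "1 \<le> exp (c0\<^sup>2 * x - 2 * x powr (1 / 15)) * exp (- (4 * x powr (3 / 4) * (2 * x powr (1 / 5) + 7)))
          * exp (- (4 * x powr (2 / 5) * (18 * x powr (13 / 24) + 7)))"
        using N6 by (simp add: exp_add[symmetric])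
      also have "\<dots> \<le> card V * (exp (- 2 * sqrt L) / 104) ^ (t + t) * (exp (- 2 * sqrt (4 * real t / A0)) / 52) ^ (B + B)"
        using n_ge l1 l2 by (intro mult_mono) auto
      finally show ?thesis .
    qed
  qed
qed

text \<open>The threshold for \<open>x\<close> is uniform in the graph. The factor 2 before
  \<open>c0\<close> leaves room for regularisation to lower both parameters.\<close>

lemma balanced_has_mono:
  fixes c0 :: real
  assumes "0 < c0" "c0 < 1"
  shows "\<forall>\<^sub>F x in at_top. \<forall>h E V. (\<forall>x y. E x y = E y x) \<longrightarrow> finite V \<longrightarrow> (\<forall>c. 2 * c0 * x \<le> h c) \<longrightarrow>
    h True + h False \<le> x \<longrightarrow> bino h \<le> exp (x powr (1 / 15) / 2) * card V \<longrightarrow> has_mono E h V"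
proof -
  define K where "K = ln (2 / c0)"
  have K: "0 < K" using assms by (simp add: K_def)
  have "\<forall>\<^sub>F x in at_top. 1 \<le> (x :: real)" "\<forall>\<^sub>F x in at_top. 2 \<le> (x :: real) powr (3 / 4)"
    "\<forall>\<^sub>F x in at_top. 2 * x powr (3 / 4) \<le> c0 * x" "\<forall>\<^sub>F x in at_top. 6 * x powr (- 1 / 3) \<le> c0"
    "\<forall>\<^sub>F x in at_top. 9 \<le> x powr (- 1 / 3) * exp ((x :: real) powr (1 / 20) / 16)"
    "\<forall>\<^sub>F x in at_top. 2 * x powr (1 / 15) + 12 * x powr (5 / 12) / c0 + 2 * x powr (2 / 5) * K
        \<le> c0 / x * (x powr (3 / 4) * (x powr (3 / 4) - 1) / 2)"
    "\<forall>\<^sub>F x in at_top. 4 * x powr (3 / 4) * (2 * x powr (1 / 5) + 7) + 4 * x powr (2 / 5) * (18 * x powr (13 / 24) + 7)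
        \<le> c0\<^sup>2 * x - 2 * x powr (1 / 15)"
    "\<forall>\<^sub>F x in at_top. 1 \<le> x powr (- 1 / 3) * exp (c0\<^sup>2 * x - 2 * x powr (1 / 15))"
    "\<forall>\<^sub>F x in at_top. (x :: real) powr (2 / 5) \<le> x powr (3 / 4)"
    "\<forall>\<^sub>F x in at_top. 2 * x powr (2 / 5) \<le> c0 * x"
    using assms(1) K by real_asymp+
  then show ?thesis
    unfolding K_def
  proof eventually_elim
    case (elim x)
    define \<gamma> where "\<gamma> = x powr (- 1 / 3)"
    define B where "B = nat \<lceil>x powr (2 / 5)\<rceil>"
    have B: "real B \<le> 2 * x powr (2 / 5)" "x powr (2 / 5) \<le> B"
      unfolding B_def using elim(1) ge_one_powr_ge_zero[of x "2 / 5"] by linarith+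
    have \<gamma>: "0 < \<gamma>" "\<gamma> \<le> 1" using elim(1,4) assms by (auto simp: \<gamma>_def)
    show ?case
    proof (intro allI impI)
      fix h0 :: "bool \<Rightarrow> nat" and E :: "nat \<Rightarrow> nat \<Rightarrow> bool" and V :: "nat set"
      assume sym: "\<forall>x y. E x y = E y x" and V: "finite V" and h0: "\<forall>c. 2 * c0 * x \<le> h0 c" "h0 True + h0 False \<le> x"
        and size: "bino h0 \<le> exp (x powr (1 / 15) / 2) * card V"
      have sym': "E x y = E y x" for x y using sym by blast
      \<comment> \<open>Since 1/15 = 2/5 - 1/3, the initial deficit fits into \<open>B\<close>
        regularisation moves.\<close>
      have "x powr (1 / 15) = x powr (2 / 5) * x powr (- 1 / 3)" by (simp add: powr_add[symmetric])
      also have "\<dots> \<le> B * \<gamma>" unfolding \<gamma>_def by (intro mult_right_mono B) auto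
      finally have "exp (x powr (1 / 15) / 2) \<le> exp (\<gamma> / 2) ^ B" by (simp add: exp_of_nat_mult[symmetric])
      also have "\<dots> \<le> (1 + \<gamma>) ^ B" using \<gamma> by (intro power_mono one_plus_ge_exp) auto
      finally have size': "bino h0 \<le> (1 + \<gamma>) ^ B * card V"
        using size by (smt (verit) mult_right_mono of_nat_0_le_iff)
      show "has_mono E h0 V"
      proof (rule regularize[of E, OF sym' \<gamma>(1) _ V order.refl _ size'])
        fix h :: "bool \<Rightarrow> nat" and U
        assume U: "finite U" and h: "\<And>c. h c \<le> h0 c \<and> h0 c \<le> h c + B" and hU: "bino h \<le> (1 + \<gamma>) ^ B * card U"
          and deg: "\<And>c x. x \<in> U \<Longrightarrow> card (nbr E c x \<inter> U) < (1 + \<gamma>) * share h c * card U"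
        show "has_mono E h U"
        proof (rule balanced_regular_case[OF assms(1) elim(1-9), of E, OF sym' U])
          show "c0 * x \<le> h c" for c
          proof -
            \<comment> \<open>Each parameter drops by at most \<open>B\<close>, hence by at most
              \<open>c0 * x\<close>.\<close>
            have "h0 c \<le> real (h c) + B" using h[of c] by (metis of_nat_add of_nat_mono)
            then show ?thesis using spec[OF h0(1), of c] B(1) elim(10) by linarith
          qed
          have "h True + h False \<le> h0 True + h0 False" using h[of True] h[of False] by linarith
          then show "h True + h False \<le> x" using h0(2) by linarith
        qed (use hU deg in \<open>simp_all add: \<gamma>_def B_def\<close>)
      qed auto
    qed
  qed
qed

section \<open>From monochromatic sets to Ramsey numbers\<close>

lemma ramsey_number_le:
  assumes "\<And>E. (\<And>x y. E x y = E y x) \<Longrightarrow> has_mono E (\<lambda>c. if c then k else l) {..<n}"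
  shows "ramsey_number (k + 1) (l + 1) \<le> n"
  unfolding ramsey_number_def
proof (rule Least_le)
  show "ramsey_prop (k + 1) (l + 1) n"
    unfolding ramsey_prop_def
  proof (intro allI impI)
    fix E :: "nat \<Rightarrow> nat \<Rightarrow> bool"
    assume "\<forall>x y. E x y = E y x"
    then have "has_mono E (\<lambda>c. if c then k else l) {..<n}" by (intro assms) blast
    then obtain c K where K: "K \<subseteq> {..<n}" "card K = (if c then k else l) + 1" "mono_clique E c K"
      unfolding has_mono_def by blast
    show "(\<exists>K\<subseteq>{..<n}. card K = k + 1 \<and> is_clique E K) \<or> (\<exists>K\<subseteq>{..<n}. card K = l + 1 \<and> is_indep E K)"
    proof (cases c)
      case True
      then have "is_clique E K" using K(3) by (simp add: mono_clique_def is_clique_def)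
      then show ?thesis using K True by auto
    next
      case False
      then have "is_indep E K" using K(3) by (simp add: mono_clique_def is_indep_def)
      then show ?thesis using K False by auto
    qed
  qed
qed

lemma bino_if: "bino (\<lambda>c. if c then k else l) = (k + l) choose k"
  by (simp add: bino_def)

lemma ramsey_number_le_binomial: "ramsey_number (k + 1) (l + 1) \<le> (k + l) choose k"
  by (rule ramsey_number_le) (auto intro!: erdos_szekeres simp: bino_if)

text \<open>The saving \<open>exp (- (x powr (1 / 15) / 2))\<close> of
  \<open>balanced_has_mono\<close> dominates any fixed power of
  \<open>exp (- (ln x)\<^sup>2)\<close>; the coefficient 1/64 is the one needed in the final
  square.\<close>

lemma ramsey_number_balanced:
  fixes c0 :: real
  assumes c0: "0 < c0" "c0 < 1"
  shows "\<forall>\<^sub>F x in at_top. \<forall>k l. 2 * c0 * x \<le> real k \<longrightarrow> 2 * c0 * x \<le> real l \<longrightarrow> real (k + l) = x \<longrightarrow>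
    real (ramsey_number (k + 1) (l + 1)) \<le> exp (- (ln x)\<^sup>2 / 64) * real ((k + l) choose k)"
proof -
  have "\<forall>\<^sub>F x in at_top. 1 \<le> (x :: real)" "\<forall>\<^sub>F x in at_top. (ln (x :: real))\<^sup>2 / 64 \<le> x powr (1 / 15) / 2 - 1"
    "\<forall>\<^sub>F x in at_top. x powr (1 / 15) / 2 \<le> (2 * c0)\<^sup>2 * x"
    using c0(1) by real_asymp+
  then show ?thesis
    using balanced_has_mono[OF c0]
  proof eventually_elim
    case (elim x)
    show ?case
    proof (intro allI impI)
      fix k l :: nat
      assume kl: "2 * c0 * x \<le> real k" "2 * c0 * x \<le> real l" "real (k + l) = x"
      define h where "h = (\<lambda>c. if c then k else l)"
      define z where "z = x powr (1 / 15) / 2"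
      define W where "W = real ((k + l) choose k)"
      define n where "n = nat \<lceil>exp (- z) * W\<rceil>"
      have W: "W = bino h" by (simp add: W_def h_def bino_if)
      have "ramsey_number (k + 1) (l + 1) \<le> n"
      proof (rule ramsey_number_le)
        fix E :: "nat \<Rightarrow> nat \<Rightarrow> bool"
        assume sym: "\<And>x y. E x y = E y x"
        have "exp (- z) * W \<le> n" unfolding n_def by linarith
        then have "exp z * (exp (- z) * W) \<le> exp z * n" by (intro mult_left_mono) auto
        then have "W \<le> exp z * n" by (simp only: mult.assoc[symmetric] exp_minus_inverse mult_1)
        moreover have "\<forall>c. 2 * c0 * x \<le> h c" "h True + h False \<le> x" using kl by (auto simp: h_def)
        ultimately have "has_mono E h {..<n}" using elim(4) sym by (simp add: W z_def)
        then show "has_mono E (\<lambda>c. if c then k else l) {..<n}" by (simp add: h_def)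
      qed
      moreover have "0 \<le> exp (- z) * W" by (simp add: W_def)
      then have "n \<le> exp (- z) * W + 1" unfolding n_def by linarith
      ultimately have R: "ramsey_number (k + 1) (l + 1) \<le> exp (- z) * W + 1" by linarith
      \<comment> \<open>This makes the 1 lost in rounding \<open>n\<close> up at most
        \<open>exp (- z) * W\<close>. The resulting factor 2 is below \<open>exp 1\<close>, which
        the - 1 in the second asymptotic condition absorbs.\<close>
      have "exp z \<le> W"
      proof -
        have "exp ((2 * c0)\<^sup>2 * x) \<le> W"
          unfolding W by (rule bino_ge_exp) (use kl c0 elim(1) in \<open>auto simp: h_def\<close>)
        moreover have "exp z \<le> exp ((2 * c0)\<^sup>2 * x)" using elim(3) by (simp add: z_def)
        ultimately show ?thesis by linarith
      qed
      then have "1 \<le> exp (- z) * W" by (simp add: exp_minus inverse_eq_divide)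
      then have "ramsey_number (k + 1) (l + 1) \<le> 2 * (exp (- z) * W)" using R by linarith
      also have "\<dots> \<le> exp 1 * (exp (- z) * W)"
        using exp_ge_add_one_self[of 1] by (intro mult_right_mono) (auto simp: W_def)
      also have "\<dots> = exp (1 - z) * W" by (simp add: mult.assoc[symmetric] exp_add[symmetric])
      also have "\<dots> \<le> exp (- (ln x)\<^sup>2 / 64) * W"
        using elim(2) by (intro mult_right_mono) (auto simp: z_def W_def)
      finally show "ramsey_number (k + 1) (l + 1) \<le> exp (- (ln x)\<^sup>2 / 64) * real ((k + l) choose k)"
        by (simp add: W_def)
    qed
  qed
qed

section \<open>Bounds on the exponent and the final case distinction\<close>

lemma tau_le_1:
  assumes "0 \<le> u" "u \<le> 1" shows "tau u \<le> 1"
proof -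
  have "1 - tau u = (1 - u) ^ 3 * (6 * u\<^sup>2 + 3 * u + 1)"
    by (simp add: tau_def algebra_simps power2_eq_square power3_eq_cube eval_nat_numeral)
  also have "\<dots> \<ge> 0" using assms by (intro mult_nonneg_nonneg) auto
  finally show ?thesis by simp
qed

lemma rho0_le:
  assumes "5 \<le> r" "0 < eps" "eps < 1 / 2" "y \<le> 1"
  shows "rho0 r eps y \<le> real r / 4"
proof (cases "y \<le> eps")
  case False
  have "tau ((y - eps) / (1 - eps)) \<le> 1"
    using assms False by (intro tau_le_1) (auto simp: divide_le_eq)
  then have "(real r - 4) * tau ((y - eps) / (1 - eps)) \<le> (real r - 4) * 1"
    using assms by (intro mult_left_mono) auto
  then show ?thesis using False by (simp add: rho0_def)
qed (simp add: rho0_def)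

lemma phi_le:
  assumes "5 \<le> r" "0 < eps" "eps < 1 / 2" "0 < k" "0 < l"
  shows "phi r eps k l \<le> real r * ln (real k + real l) / 4"
proof -
  have "rho r eps (real l / real k) \<le> real r / 4"
    unfolding rho_def using assms by (auto intro!: rho0_le simp del: le_divide_eq_numeral1)
  then have "phi r eps k l \<le> real r / 4 * ln (real k + real l)"
    unfolding phi_def using assms by (intro mult_right_mono) auto
  then show ?thesis by simp
qed

text \<open>In the unbalanced range nothing beyond Erdos-Szekeres is claimed.\<close>

lemma phi_eq_0:
  assumes "eps < 1 / 2" "0 < k" "0 < l" "real l \<le> eps * real k \<or> real k \<le> eps * real l"
  shows "phi r eps k l = 0"
proof -
  have "rho r eps (real l / real k) = 0"
    using assms(4)
  proof
    assume "real l \<le> eps * real k"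
    then have "real l / real k \<le> eps" using assms by (simp add: pos_divide_le_eq)
    then show ?thesis using assms(1) unfolding rho_def rho0_def by (simp del: le_divide_eq_1_pos divide_le_eq_1_pos)
  next
    assume le: "real k \<le> eps * real l"
    then have "real k / real l \<le> eps" using assms by (simp add: pos_divide_le_eq)
    moreover have "eps * real l < 1 * real l" using assms by (intro mult_strict_right_mono) auto
    then have "real k < real l" using le by linarith
    then have "\<not> real l / real k \<le> 1" using assms by simp
    ultimately show ?thesis unfolding rho_def rho0_def by simp
  qed
  then show ?thesis by (simp add: phi_def)
qed

theorem theorem4p8:
  fixes eps :: real
  assumes "0 < eps" and "eps < 1/2"
  shows "\<exists>C>0. \<forall>r::nat. \<forall>k::nat. \<forall>l::nat. r \<ge> 5 \<longrightarrow> k > 0 \<longrightarrow> l > 0 \<longrightarrow>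
           real (ramsey_number (k + 1) (l + 1))
             \<le> 2 powr (C * real r ^ 2) * exp (- phi r eps k l) * real ((k + l) choose k)"
proof -
  \<comment> \<open>Balance up to \<open>eps\<close> makes each of \<open>k\<close> and
    \<open>l\<close> at least \<open>eps / 2\<close> times \<open>k + l\<close>, and this fraction
    is \<open>2 * c0\<close>.\<close>
  define c0 where "c0 = eps / 4"
  have c0: "0 < c0" "c0 < 1" using assms by (auto simp: c0_def)
  obtain x0 where x0: "1 \<le> x0" and large: "\<And>k l. 2 * c0 * real (k + l) \<le> real k \<Longrightarrow> 2 * c0 * real (k + l) \<le> real l \<Longrightarrow>
      x0 \<le> real (k + l) \<Longrightarrow>
      real (ramsey_number (k + 1) (l + 1)) \<le> exp (- (ln (real (k + l)))\<^sup>2 / 64) * real ((k + l) choose k)"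
  proof -
    obtain b where "\<forall>x\<ge>b. \<forall>k l. 2 * c0 * x \<le> real k \<longrightarrow> 2 * c0 * x \<le> real l \<longrightarrow> real (k + l) = x \<longrightarrow>
      real (ramsey_number (k + 1) (l + 1)) \<le> exp (- (ln x)\<^sup>2 / 64) * real ((k + l) choose k)"
      using ramsey_number_balanced[OF c0] unfolding eventually_at_top_linorder by blast
    then show ?thesis by (intro that[of "max 1 b"]) auto
  qed
  \<comment> \<open>\<open>x0\<close> depends on \<open>eps\<close> only. Half of
    \<open>C * real r ^ 2\<close> covers \<open>real r ^ 2 + real r * ln x0 / 2\<close>, and
    \<open>ln 2\<close> exceeds 1/2.\<close>
  define C where "C = 2 + ln x0"
  have C: "0 < C" using x0 by (simp add: C_def add_pos_nonneg)
  have const: "exp (real r ^ 2 + real r * ln x0 / 2) \<le> 2 powr (C * real r ^ 2)" if "5 \<le> r" for r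
  proof -
    have "real r * ln x0 \<le> real r ^ 2 * ln x0"
      using that x0 by (intro mult_right_mono) (auto simp: power2_eq_square)
    then have "real r ^ 2 + real r * ln x0 / 2 \<le> C * real r ^ 2 * (1 / 2)"
      by (simp add: C_def algebra_simps)
    also have "\<dots> \<le> C * real r ^ 2 * ln 2"
      using C ln2_ge_two_thirds by (intro mult_left_mono) auto
    finally show ?thesis by (simp add: powr_def)
  qed
  show ?thesis
  proof (intro exI[of _ C] conjI allI impI C)
    fix r k l :: nat
    assume r: "5 \<le> r" and k: "0 < k" and l: "0 < l"
    define x where "x = real k + real l"
    have x1: "1 \<le> x" using k l by (simp add: x_def)
    \<comment> \<open>Here \<open>s\<close> is the logarithmic gain over the binomial bound; it is 0
      in the first two cases.\<close>
    have upper: "real (ramsey_number (k + 1) (l + 1)) \<le> exp (- s) * real ((k + l) choose k) \<Longrightarrow>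
        phi r eps k l \<le> real r ^ 2 + real r * ln x0 / 2 + s \<Longrightarrow>
        real (ramsey_number (k + 1) (l + 1)) \<le> 2 powr (C * real r ^ 2) * exp (- phi r eps k l) * real ((k + l) choose k)"
      for s
    proof -
      assume 1: "real (ramsey_number (k + 1) (l + 1)) \<le> exp (- s) * real ((k + l) choose k)"
        and 2: "phi r eps k l \<le> real r ^ 2 + real r * ln x0 / 2 + s"
      have "exp (- s) \<le> exp (real r ^ 2 + real r * ln x0 / 2) * exp (- phi r eps k l)"
        unfolding exp_add[symmetric] using 2 by simp
      also have "\<dots> \<le> 2 powr (C * real r ^ 2) * exp (- phi r eps k l)"
        using const[OF r] by (intro mult_right_mono) auto
      finally have "exp (- s) * real ((k + l) choose k) \<le> 2 powr (C * real r ^ 2) * exp (- phi r eps k l) * real ((k + l) choose k)"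
        by (intro mult_right_mono) auto
      then show ?thesis using 1 by linarith
    qed
    have trivial: "real (ramsey_number (k + 1) (l + 1)) \<le> exp (- 0) * real ((k + l) choose k)"
      using ramsey_number_le_binomial[of k l] by simp
    have phi_r: "phi r eps k l \<le> real r * ln x / 4"
      using phi_le[OF r assms k l] by (simp add: x_def)
    consider "real l \<le> eps * real k \<or> real k \<le> eps * real l" | "x \<le> x0"
      | "x0 \<le> x" "eps * real k \<le> real l" "eps * real l \<le> real k"
      by linarith
    then show "real (ramsey_number (k + 1) (l + 1)) \<le> 2 powr (C * real r ^ 2) * exp (- phi r eps k l) * real ((k + l) choose k)"
    proof cases
      case 1
      then have "phi r eps k l = 0" by (intro phi_eq_0 assms k l)
      then show ?thesis using x0 by (intro upper[OF trivial]) simp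
    next
      case 2
      have "ln x \<le> ln x0" using 2 x1 by simp
      then have "real r * ln x \<le> real r * ln x0" by (intro mult_left_mono) auto
      moreover have "0 \<le> real r * ln x0" using x0 by simp
      ultimately show ?thesis using phi_r by (intro upper[OF trivial]) (simp add: add_increasing)
    next
      case 3
      have "eps * real k \<le> real k" "eps * real l \<le> real l" using assms by (simp_all add: mult_left_le_one_le)
      then have "2 * c0 * real (k + l) \<le> real k" "2 * c0 * real (k + l) \<le> real l"
        using 3(2,3) by (simp_all add: c0_def algebra_simps)
      then have "real (ramsey_number (k + 1) (l + 1)) \<le> exp (- ((ln x)\<^sup>2 / 64)) * real ((k + l) choose k)"
        using large[of k l] 3(1) by (simp add: x_def)
      \<comment> \<open>Completing the square splits \<open>real r * ln x / 4\<close> into the part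
        paid by \<open>C\<close> and the part paid by the gain, whence the 64.\<close>
      moreover have "0 \<le> (real r - ln x / 8)\<^sup>2" by simp
      then have "real r * ln x / 4 \<le> real r ^ 2 + (ln x)\<^sup>2 / 64"
        by (simp add: power2_eq_square algebra_simps)
      then have "phi r eps k l \<le> real r ^ 2 + real r * ln x0 / 2 + (ln x)\<^sup>2 / 64"
        using phi_r x0 by (smt (verit) divide_nonneg_pos ln_ge_zero mult_nonneg_nonneg of_nat_0_le_iff)
      ultimately show ?thesis by (rule upper)
    qed
  qed
qed

end
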